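(* Let $h(r),f(r)$ be invertible functions of $r$, $c$ a nonzero constant, and let $M=\mathbb{R}^3\setminus\{0\}$ with metric $\bar g=h(r)^2\bar{\mathrm d}r\otimes\bar{\mathrm d}r+\omega_i\otimes\omega_i$ and radial conformal Killing vector field $\tau=\frac r{h(r)}\frac\partial{\partial r}$. The quantum calculus $\Omega^1(C(M)\rtimes_\tau\mathbb{R})$ quantizing the static metric $-f(r)^2\bar{\mathrm d}t\otimes\bar{\mathrm d}t+h(r)^2\bar{\mathrm d}r\otimes\bar{\mathrm d}r+\omega_i\otimes\omega_i$ with respect to $\tau$, i.e. with parameter $\beta=-\frac1{c^2f(r)^2}$, has relations \[[x_i,x_j]=0,\quad[x_i,t]=\tfrac\lambda hx_i,\quad[\omega_i,x_j]=\lambda e_{ij}\theta',\quad[\mathrm dr,x_i]=\tfrac\lambda{h^2}\tfrac{x_i}r\theta',\quad[\theta',x_i]=0,\] \[[\omega_i,t]=\lambda\big(\tfrac1h-1\big)\omega_i,\quad[\theta',t]=\lambda\big(\tfrac2h-1\big)\theta',\quad[x_i,\mathrm dt]=\lambda\,\mathrm dx_i,\quad[\mathrm dt,t]=\beta\lambda\theta'-\lambda\,\mathrm dt,\] \[[\mathrm dr,t]=\lambda\big(\mathrm d(\tfrac rh)-\mathrm dr\big),\qquad\mathrm dg(r)=g'(r)\,\mathrm dr+\tfrac\lambda{2h^2}g''(r)\theta'\] for any function $g(r)$.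
   Context: $x_1,x_2,x_3$ are the Cartesian coordinates, $r^2=\sum_ix_i^2$, $e_{ij}=\delta_{ij}-\frac{x_ix_j}{r^2}$, and $\omega_i=e_{ik}\bar{\mathrm d}x_k=\bar{\mathrm d}x_i-\frac{x_i}r\bar{\mathrm d}r$ (bars denote classical objects; repeated indices are summed; $\frac\partial{\partial r}$ is the radial vector field $\frac1rx_i\frac\partial{\partial x_i}$). $\lambda$ is the deformation parameter. The inverse metric $(\ ,\ )$ has $(\bar{\mathrm d}r,\bar{\mathrm d}r)=h^{-2}$, $(\bar{\mathrm d}r,\omega_i)=0$, $(\omega_i,\omega_j)=e_{ij}$. Here $n=\dim M=3$ and $\alpha=\frac2n\mathrm{div}(\tau)-1=\frac2h-1$. $C(M)\rtimes_\tau\mathbb{R}$ is generated by $C(M)$ and $t$ with $[a,t]=\lambda\tau(a)$ for $a\in C(M)$. The calculus is generated by the classical 1-forms $\bar\Omega^1(M)$, $\theta'$ and $\mathrm dt$ with, for $\omega\in\bar\Omega^1(M)$, $a\in C(M)$, \[[\omega,a]=\lambda(\omega,\bar{\mathrm d}a)\theta',\quad[\theta',a]=0,\quad[\theta',t]=\alpha\lambda\theta',\quad[a,\mathrm dt]=\lambda\,\mathrm da,\quad[\mathrm dt,t]=\beta\lambda\theta'-\lambda\,\mathrm dt,\] \[[\omega,t]=\lambda(\bar{\mathcal L}_\tau-\mathrm{id})\omega-\lambda^2\tfrac{n-2}4(\bar{\mathrm d}\alpha,\omega)\theta'-\tfrac{\lambda^2}2(\bar{\mathcal L}_\tau\zeta^*,\omega)\theta',\]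 where $\zeta^*=-\frac12\beta^{-1}\bar{\mathrm d}\beta$ is the 1-form dual to the vector field $\zeta$, $\bar{\mathcal L}_\tau$ is the Lie derivative, and $\mathrm d$ is a derivation with $\mathrm da=\bar{\mathrm d}a+\frac\lambda2(\bar\Delta a)\theta'$ for $a\in C(M)$, $\bar\Delta=\bar\Delta_{LB}+\zeta$ with $\bar\Delta_{LB}$ the Laplace-Beltrami operator of $\bar g$. *)

theory Defs
  imports "HOL-Analysis.Analysis"
begin

section \<open>Smooth functions\<close>

text \<open>Meant for open \<open>S\<close>: all iterated directional derivatives exist and are continuous on \<open>S\<close>.\<close>

primrec Ck_on :: "nat \<Rightarrow> 'v::real_normed_vector set \<Rightarrow> ('v \<Rightarrow> 'b::real_normed_vector) \<Rightarrow> bool" where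
  "Ck_on 0 S f \<longleftrightarrow> continuous_on S f"
| "Ck_on (Suc n) S f \<longleftrightarrow> (\<forall>x\<in>S. f differentiable at x) \<and>
     (\<forall>v. Ck_on n S (\<lambda>x. frechet_derivative f (at x) v))"

definition smooth_on :: "'v::real_normed_vector set \<Rightarrow> ('v \<Rightarrow> 'b::real_normed_vector) \<Rightarrow> bool" where
  "smooth_on S f \<longleftrightarrow> (\<forall>n. Ck_on n S f)"

section \<open>Classical geometry on an open subset of Euclidean space\<close>

text \<open>
  The ground field \<open>'k :: real_normed_field\<close> is the real or the complex field.  Metrics and vector
  fields are real.  Functions and 1-forms are \<open>'k\<close>-valued, and the metric is extended
  \<open>'k\<close>-bilinearly to them (no complex conjugation).  Metrics, vector fields and 1-forms are given by
  their components in the Cartesian coordinates; only the values on the open set \<open>M\<close> matter.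
\<close>

type_synonym 'n metric = "real^'n \<Rightarrow> real^'n^'n"
type_synonym 'n vfield = "real^'n \<Rightarrow> real^'n"
type_synonym ('k, 'n) form = "real^'n \<Rightarrow> 'k^'n"

definition CM :: "(real^'n) set \<Rightarrow> (real^'n \<Rightarrow> 'k::real_normed_field) set" where
  "CM M = {a. smooth_on M a}"

definition forms :: "(real^'n) set \<Rightarrow> ('k::real_normed_field, 'n::finite) form set" where
  "forms M = {\<omega>. \<forall>i. smooth_on M (\<lambda>x. \<omega> x $ i)}"

definition cfun :: "(real^'n \<Rightarrow> real) \<Rightarrow> real^'n \<Rightarrow> 'k::real_normed_field" where
  "cfun a = (\<lambda>x. of_real (a x))"

definition cform :: "(real, 'n::finite) form \<Rightarrow> ('k::real_normed_field, 'n::finite) form" where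
  "cform \<omega> = (\<lambda>x. \<chi> i. of_real (\<omega> x $ i))"

definition pd :: "'n \<Rightarrow> (real^'n \<Rightarrow> 'k::real_normed_field) \<Rightarrow> real^'n \<Rightarrow> 'k" where
  "pd i a x = frechet_derivative a (at x) (axis i 1)"

definition dcl :: "(real^'n \<Rightarrow> 'k::real_normed_field) \<Rightarrow> ('k, 'n::finite) form" where
  "dcl a = (\<lambda>x. \<chi> i. pd i a x)"

definition vf_apply :: "'n::finite vfield \<Rightarrow> (real^'n \<Rightarrow> 'k::real_normed_field) \<Rightarrow> real^'n \<Rightarrow> 'k" where
  "vf_apply X a = (\<lambda>x. \<Sum>i\<in>UNIV. (X x $ i) *\<^sub>R pd i a x)"

text \<open>The Lie derivative: \<open>(L\<^sub>X \<omega>)\<^sub>i = X\<^sub>j \<partial>\<^sub>j \<omega>\<^sub>i + \<omega>\<^sub>j \<partial>\<^sub>i X\<^sub>j\<close>, and likewise for a metric.\<close>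

definition lie_form :: "'n::finite vfield \<Rightarrow> ('k::real_normed_field, 'n::finite) form \<Rightarrow> ('k, 'n::finite) form" where
  "lie_form X \<omega> = (\<lambda>x. \<chi> i. vf_apply X (\<lambda>y. \<omega> y $ i) x
      + (\<Sum>j\<in>UNIV. pd i (\<lambda>y. X y $ j) x *\<^sub>R (\<omega> x $ j)))"

definition lie_metric :: "'n::finite vfield \<Rightarrow> 'n::finite metric \<Rightarrow> 'n::finite metric" where
  "lie_metric X g = (\<lambda>x. \<chi> i j. vf_apply X (\<lambda>y. g y $ i $ j) x
      + (\<Sum>k\<in>UNIV. g x $ k $ j * pd i (\<lambda>y. X y $ k) x)
      + (\<Sum>k\<in>UNIV. g x $ i $ k * pd j (\<lambda>y. X y $ k) x))"

definition conformal_killing :: "(real^'n) set \<Rightarrow> 'n::finite metric \<Rightarrow> 'n::finite vfield \<Rightarrow> bool" where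
  "conformal_killing M g X \<longleftrightarrow> (\<exists>\<phi>. smooth_on M \<phi> \<and> (\<forall>x\<in>M. lie_metric X g x = \<phi> x *\<^sub>R g x))"

text \<open>The inverse metric \<open>( , )\<close> on 1-forms.\<close>

definition ip :: "'n::finite metric \<Rightarrow> ('k::real_normed_field, 'n::finite) form \<Rightarrow> ('k, 'n::finite) form \<Rightarrow> real^'n \<Rightarrow> 'k" where
  "ip g \<omega> \<eta> = (\<lambda>x. \<Sum>i\<in>UNIV. \<Sum>j\<in>UNIV. (matrix_inv (g x) $ i $ j) *\<^sub>R (\<omega> x $ i * \<eta> x $ j))"

definition sharp :: "'n::finite metric \<Rightarrow> (real, 'n::finite) form \<Rightarrow> 'n::finite vfield" where
  "sharp g \<omega> = (\<lambda>x. matrix_inv (g x) *v \<omega> x)"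

definition vol :: "'n::finite metric \<Rightarrow> real^'n \<Rightarrow> real" where
  "vol g x = sqrt \<bar>det (g x)\<bar>"

definition divergence :: "'n::finite metric \<Rightarrow> 'n::finite vfield \<Rightarrow> real^'n \<Rightarrow> real" where
  "divergence g X x = (\<Sum>i\<in>UNIV. pd i (\<lambda>y. vol g y * X y $ i) x) / vol g x"

definition laplace_beltrami ::
    "'n::finite metric \<Rightarrow> (real^'n \<Rightarrow> 'k::real_normed_field) \<Rightarrow> real^'n \<Rightarrow> 'k" where
  "laplace_beltrami g a = (\<lambda>x. (\<Sum>i\<in>UNIV. pd i (\<lambda>y. vol g y *\<^sub>R
      (\<Sum>j\<in>UNIV. (matrix_inv (g y) $ i $ j) *\<^sub>R pd j a y)) x) /\<^sub>R vol g x)"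

definition zeta_form :: "(real^'n \<Rightarrow> real) \<Rightarrow> (real, 'n::finite) form" where
  "zeta_form \<beta> = (\<lambda>x. (- (1/2) * inverse (\<beta> x)) *\<^sub>R dcl \<beta> x)"

definition Delta :: "'n::finite metric \<Rightarrow> (real^'n \<Rightarrow> real) \<Rightarrow> (real^'n \<Rightarrow> 'k::real_normed_field) \<Rightarrow> real^'n \<Rightarrow> 'k" where
  "Delta g \<beta> a = (\<lambda>x. laplace_beltrami g a x + vf_apply (sharp g (zeta_form \<beta>)) a x)"

definition alpha :: "'n::finite metric \<Rightarrow> 'n::finite vfield \<Rightarrow> real^'n \<Rightarrow> real" where
  "alpha g \<tau> x = 2 / real CARD('n) * divergence g \<tau> x - 1"

section \<open>The quantum calculus on the cross product\<close>

locale unital_algebra = vector_space scale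
  for scale :: "'k::field \<Rightarrow> 'a::ring_1 \<Rightarrow> 'a" +
  assumes scale_mult_left: "scale c a * b = scale c (a * b)"
    and scale_mult_right: "a * scale c b = scale c (a * b)"

locale bimodule = A: unital_algebra scaleA + W: vector_space scaleW
  for scaleA :: "'k::field \<Rightarrow> 'a::ring_1 \<Rightarrow> 'a"
    and scaleW :: "'k \<Rightarrow> 'w::ab_group_add \<Rightarrow> 'w" +
  fixes lact :: "'a \<Rightarrow> 'w \<Rightarrow> 'w" (infixr "\<triangleright>" 75)
    and ract :: "'w \<Rightarrow> 'a \<Rightarrow> 'w" (infixl "\<triangleleft>" 75)
  assumes lact_one: "1 \<triangleright> w = w"
    and lact_mult: "(a * b) \<triangleright> w = a \<triangleright> b \<triangleright> w"
    and lact_add_left: "(a + b) \<triangleright> w = a \<triangleright> w + b \<triangleright> w"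
    and lact_add_right: "a \<triangleright> (v + w) = a \<triangleright> v + a \<triangleright> w"
    and lact_scale_left: "scaleA k a \<triangleright> w = scaleW k (a \<triangleright> w)"
    and lact_scale_right: "a \<triangleright> scaleW k w = scaleW k (a \<triangleright> w)"
    and ract_one: "w \<triangleleft> 1 = w"
    and ract_mult: "w \<triangleleft> (a * b) = w \<triangleleft> a \<triangleleft> b"
    and ract_add_left: "(v + w) \<triangleleft> a = v \<triangleleft> a + w \<triangleleft> a"
    and ract_add_right: "w \<triangleleft> (a + b) = w \<triangleleft> a + w \<triangleleft> b"
    and ract_scale_left: "scaleW k w \<triangleleft> a = scaleW k (w \<triangleleft> a)"
    and ract_scale_right: "w \<triangleleft> scaleA k a = scaleW k (w \<triangleleft> a)"
    and assoc: "(a \<triangleright> w) \<triangleleft> b = a \<triangleright> (w \<triangleleft> b)"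

text \<open>
  \<open>'a\<close> plays the role of the cross product of \<open>C(M)\<close> by \<open>\<tau>\<close> and \<open>'w\<close> that of its bimodule of
  1-forms.  The maps \<open>fn\<close> and \<open>form\<close> send a classical function, resp. 1-form, to the corresponding
  generator; \<open>form\<close> is left \<open>C(M)\<close>-linear, i.e. the left product of a function with a classical
  1-form is the classical one.  Any \<open>'a\<close> and \<open>'w\<close> satisfying the defining relations are allowed, in
  particular the universal ones.
\<close>

locale quantum_calculus = bimodule scaleA scaleW lact ract
  for M :: "(real^'n) set"
    and g :: "'n::finite metric"
    and \<tau> :: "'n::finite vfield"
    and \<beta> :: "real^'n \<Rightarrow> real"
    and lam :: "'k::real_normed_field"
    and scaleA :: "'k \<Rightarrow> 'a::ring_1 \<Rightarrow> 'a"
    and scaleW :: "'k \<Rightarrow> 'w::ab_group_add \<Rightarrow> 'w"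
    and lact :: "'a \<Rightarrow> 'w \<Rightarrow> 'w" (infixr "\<triangleright>" 75)
    and ract :: "'w \<Rightarrow> 'a \<Rightarrow> 'w" (infixl "\<triangleleft>" 75)
    and fn :: "(real^'n \<Rightarrow> 'k) \<Rightarrow> 'a"
    and form :: "('k, 'n::finite) form \<Rightarrow> 'w"
    and t :: 'a
    and \<theta> :: 'w
    and d :: "'a \<Rightarrow> 'w" +
  assumes fn_cong: "\<lbrakk>a \<in> CM M; b \<in> CM M; \<And>x. x \<in> M \<Longrightarrow> a x = b x\<rbrakk> \<Longrightarrow> fn a = fn b"
    and fn_const: "fn (\<lambda>x. k) = scaleA k 1"
    and fn_add: "\<lbrakk>a \<in> CM M; b \<in> CM M\<rbrakk> \<Longrightarrow> fn (\<lambda>x. a x + b x) = fn a + fn b"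
    and fn_mult: "\<lbrakk>a \<in> CM M; b \<in> CM M\<rbrakk> \<Longrightarrow> fn (\<lambda>x. a x * b x) = fn a * fn b"
    and fn_t: "a \<in> CM M \<Longrightarrow> fn a * t - t * fn a = scaleA lam (fn (vf_apply \<tau> a))"
    and generated_algebra:
      "\<lbrakk>A.subspace B; 1 \<in> B; \<And>a b. a \<in> B \<Longrightarrow> b \<in> B \<Longrightarrow> a * b \<in> B;
        fn ` CM M \<subseteq> B; t \<in> B\<rbrakk> \<Longrightarrow> B = UNIV"
    and form_cong:
      "\<lbrakk>\<omega> \<in> forms M; \<eta> \<in> forms M; \<And>x. x \<in> M \<Longrightarrow> \<omega> x = \<eta> x\<rbrakk> \<Longrightarrow> form \<omega> = form \<eta>"
    and form_add: "\<lbrakk>\<omega> \<in> forms M; \<eta> \<in> forms M\<rbrakk> \<Longrightarrow> form (\<lambda>x. \<omega> x + \<eta> x) = form \<omega> + form \<eta>"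
    and form_mult: "\<lbrakk>a \<in> CM M; \<omega> \<in> forms M\<rbrakk> \<Longrightarrow> form (\<lambda>x. a x *s \<omega> x) = fn a \<triangleright> form \<omega>"
    and generated_bimodule:
      "\<lbrakk>W.subspace V; \<And>a w. w \<in> V \<Longrightarrow> a \<triangleright> w \<in> V; \<And>a w. w \<in> V \<Longrightarrow> w \<triangleleft> a \<in> V;
        form ` forms M \<subseteq> V; \<theta> \<in> V; d t \<in> V\<rbrakk> \<Longrightarrow> V = UNIV"
    and d_add: "d (u + v) = d u + d v"
    and d_scale: "d (scaleA k u) = scaleW k (d u)"
    and d_mult: "d (u * v) = d u \<triangleleft> v + u \<triangleright> d v"
    and d_fn: "a \<in> CM M \<Longrightarrow> d (fn a) = form (dcl a) + scaleW (lam / 2) (fn (Delta g \<beta> a) \<triangleright> \<theta>)"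
    and form_fn: "\<lbrakk>\<omega> \<in> forms M; a \<in> CM M\<rbrakk> \<Longrightarrow>
      form \<omega> \<triangleleft> fn a - fn a \<triangleright> form \<omega> = scaleW lam (fn (ip g \<omega> (dcl a)) \<triangleright> \<theta>)"
    and theta_fn: "a \<in> CM M \<Longrightarrow> \<theta> \<triangleleft> fn a - fn a \<triangleright> \<theta> = 0"
    and theta_t: "\<theta> \<triangleleft> t - t \<triangleright> \<theta> = scaleW lam (fn (cfun (alpha g \<tau>)) \<triangleright> \<theta>)"
    and fn_dt: "a \<in> CM M \<Longrightarrow> fn a \<triangleright> d t - d t \<triangleleft> fn a = scaleW lam (d (fn a))"
    and dt_t: "d t \<triangleleft> t - t \<triangleright> d t = scaleW lam (fn (cfun \<beta>) \<triangleright> \<theta>) - scaleW lam (d t)"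
    and form_t: "\<omega> \<in> forms M \<Longrightarrow>
      form \<omega> \<triangleleft> t - t \<triangleright> form \<omega> =
        scaleW lam (form (lie_form \<tau> \<omega>) - form \<omega>)
        - scaleW (lam\<^sup>2 * of_real ((real CARD('n) - 2) / 4))
            (fn (ip g (dcl (cfun (alpha g \<tau>))) \<omega>) \<triangleright> \<theta>)
        - scaleW (lam\<^sup>2 / 2) (fn (ip g (cform (lie_form \<tau> (zeta_form \<beta>))) \<omega>) \<triangleright> \<theta>)"

section \<open>The static, spherically symmetric case\<close>

definition punctured_space :: "(real^3) set" where
  "punctured_space = UNIV - {0}"

definition proj_e :: "3 \<Rightarrow> 3 \<Rightarrow> real^3 \<Rightarrow> real" where
  "proj_e i j x = (if i = j then 1 else 0) - x $ i * x $ j / (norm x)\<^sup>2"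

definition omega :: "3 \<Rightarrow> (real, 3) form" where
  "omega i = (\<lambda>x. \<Sum>k\<in>UNIV. proj_e i k x *\<^sub>R dcl (\<lambda>y. y $ k) x)"

definition spatial_metric :: "(real \<Rightarrow> real) \<Rightarrow> 3 metric" where
  "spatial_metric h = (\<lambda>x. \<chi> a b. (h (norm x))\<^sup>2 * (dcl norm x $ a * dcl norm x $ b)
      + (\<Sum>i\<in>UNIV. omega i x $ a * omega i x $ b))"

definition d_dr :: "3 vfield" where
  "d_dr x = (1 / norm x) *\<^sub>R x"

definition radial_tau :: "(real \<Rightarrow> real) \<Rightarrow> 3 vfield" where
  "radial_tau h = (\<lambda>x. (norm x / h (norm x)) *\<^sub>R d_dr x)"

definition static_beta :: "real \<Rightarrow> (real \<Rightarrow> real) \<Rightarrow> real^3 \<Rightarrow> real" where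
  "static_beta c f = (\<lambda>x. - (1 / (c\<^sup>2 * (f (norm x))\<^sup>2)))"

end

theory Submission
  imports Defs
begin

text \<open>
  Everything is governed by the splitting of \<open>\<real>\<^sup>3\<close> without the origin into the radial direction and its
  orthogonal complement.  At each point the metric is the identity stretched by \<open>h(r)\<^sup>2\<close> along \<open>x\<close>, so its
  inverse and its determinant \<open>h(r)\<^sup>2\<close> are explicit (\<open>radial_matrix\<close>), and \<open>\<tau> = x / h(r)\<close> is a multiple of the
  Euler field.  Hence \<open>\<tau>\<close> is conformal with factor \<open>2 / h\<close>, its divergence is \<open>3 / h\<close>, it sends \<open>x\<^sub>i\<close> to
  \<open>x\<^sub>i / h\<close> and \<open>r\<close> to \<open>r / h\<close>, and \<open>L\<^sub>\<tau> \<omega>\<^sub>i = \<omega>\<^sub>i / h\<close>.  These values, together with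
  \<open>(\<omega>\<^sub>i, dx\<^sub>j) = e\<^sub>i\<^sub>j\<close> and \<open>(dr, dx\<^sub>i) = x\<^sub>i / (r h\<^sup>2)\<close>, turn the defining relations of the calculus into
  most of those asserted.

  Three relations need an argument.  In \<open>[\<omega>\<^sub>i, t]\<close> the terms of order \<open>\<lambda>\<^sup>2\<close> pair \<open>\<omega>\<^sub>i\<close> with \<open>d\<alpha>\<close> and with
  \<open>L\<^sub>\<tau> \<zeta>\<^sup>*\<close>; these 1-forms are radial and \<open>\<omega>\<^sub>i\<close> is tangential, so the terms vanish (\<open>omega_t\<close>).  The formula for
  \<open>[dr, t]\<close> results from applying the derivation \<open>d\<close> to \<open>[r, t] = \<lambda> r / h\<close> and using \<open>[r, dt] = \<lambda> dr\<close>
  (\<open>d_fn_t_commutator\<close>).  For \<open>d g(r)\<close>, the Laplacian of a radial function is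
  \<open>\<Delta> g(r) = g'(r) \<Delta> r + g''(r) / h\<^sup>2\<close> (\<open>Delta_radial\<close>), and the terms with \<open>\<Delta> r\<close> are absorbed when the
  classical \<open>dr\<close> is replaced by the quantum one (\<open>d_radial\<close>).

  The relations of the calculus apply only to smooth functions and forms, so all coefficients that occur
  must be shown to be smooth away from the origin.  They are built from coordinates and from functions of
  \<open>r\<close> by field operations, and smoothness is closed under these.
\<close>

section \<open>Closure properties of smooth functions\<close>

lemma frechet_derivative_cong_open:
  assumes "open S" "x \<in> S" "\<And>y. y \<in> S \<Longrightarrow> f y = g y"
  shows "frechet_derivative f (at x) = frechet_derivative g (at x)"
proof -
  have "(f has_derivative D) (at x) \<longleftrightarrow> (g has_derivative D) (at x)" for D
    using assms has_derivative_transform_within_open[of f D x UNIV S g]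
      has_derivative_transform_within_open[of g D x UNIV S f] by auto
  then show ?thesis
    unfolding frechet_derivative_def by simp
qed

lemma Ck_on_cong:
  assumes "open S" "\<And>x. x \<in> S \<Longrightarrow> f x = g x"
  shows "Ck_on n S f \<longleftrightarrow> Ck_on n S g"
  using assms(2)
proof (induction n arbitrary: f g)
  case 0
  then show ?case by (simp cong: continuous_on_cong)
next
  case (Suc n)
  have "f differentiable at x \<longleftrightarrow> g differentiable at x" if "x \<in> S" for x
    unfolding differentiable_def
    using assms(1) that Suc.prems has_derivative_transform_within_open[of f _ x UNIV S g]
      has_derivative_transform_within_open[of g _ x UNIV S f] by metis
  moreover have "Ck_on n S (\<lambda>x. frechet_derivative f (at x) v) \<longleftrightarrow>
      Ck_on n S (\<lambda>x. frechet_derivative g (at x) v)" for v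
    using frechet_derivative_cong_open[OF assms(1) _ Suc.prems] by (intro Suc.IH) auto
  ultimately show ?case by simp
qed

text \<open>
  The recursive clause speaks of \<^const>\<open>frechet_derivative\<close>, a choice that the product and chain rules
  do not mention; this form accepts any pointwise derivative that those rules produce.
\<close>

lemma Ck_on_SucI:
  assumes "open S" "\<And>x. x \<in> S \<Longrightarrow> (f has_derivative f' x) (at x)"
    and "\<And>v. Ck_on n S (\<lambda>x. f' x v)"
  shows "Ck_on (Suc n) S f"
proof -
  have "Ck_on n S (\<lambda>x. frechet_derivative f (at x) v)" for v
    using assms(3)[of v] Ck_on_cong[OF assms(1), of "\<lambda>x. f' x v" "\<lambda>x. frechet_derivative f (at x) v" n]
      frechet_derivative_at[OF assms(2)] by simp
  then show ?thesis using assms(2) unfolding Ck_on.simps differentiable_def by blast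
qed

lemma Ck_on_has_derivative:
  assumes "Ck_on (Suc n) S f" "x \<in> S"
  shows "(f has_derivative frechet_derivative f (at x)) (at x)"
  using assms frechet_derivative_works by auto

lemma Ck_on_SucD: "Ck_on (Suc n) S f \<Longrightarrow> Ck_on n S f"
proof (induction n arbitrary: f)
  case 0
  then show ?case
    by (auto intro!: continuous_at_imp_continuous_on differentiable_imp_continuous_within)
next
  case (Suc n)
  then show ?case unfolding Ck_on.simps(2)[of "Suc n"] Ck_on.simps(2)[of n S f] by blast
qed

lemma Ck_on_const: "open S \<Longrightarrow> Ck_on n S (\<lambda>x. k)"
proof (induction n arbitrary: k)
  case (Suc n)
  show ?case by (rule Ck_on_SucI[where f' = "\<lambda>x v. 0"]) (use Suc in auto)
qed simp

lemma Ck_on_id: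
  assumes "open S"
  shows "Ck_on n S (\<lambda>x. x)"
proof (cases n)
  case (Suc m)
  show ?thesis unfolding Suc
    by (rule Ck_on_SucI[OF assms, where f' = "\<lambda>x v. v"]) (auto intro: Ck_on_const[OF assms])
qed simp

lemma Ck_on_bounded_linear:
  assumes "open S" "bounded_linear L"
  shows "Ck_on n S f \<Longrightarrow> Ck_on n S (\<lambda>x. L (f x))"
proof (induction n arbitrary: f)
  case 0
  then show ?case by (simp add: bounded_linear.continuous_on[OF assms(2)])
next
  case (Suc n)
  show ?case
    by (rule Ck_on_SucI[OF assms(1)
          bounded_linear.has_derivative[OF assms(2) Ck_on_has_derivative[OF Suc.prems]]])
      (use Suc in auto)
qed

lemma Ck_on_add:
  assumes "open S"
  shows "Ck_on n S f \<Longrightarrow> Ck_on n S g \<Longrightarrow> Ck_on n S (\<lambda>x. f x + g x)"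
proof (induction n arbitrary: f g)
  case 0
  then show ?case by (simp add: continuous_on_add)
next
  case (Suc n)
  show ?case
    by (rule Ck_on_SucI[OF assms has_derivative_add[OF Ck_on_has_derivative[OF Suc.prems(1)]
          Ck_on_has_derivative[OF Suc.prems(2)]]])
      (use Suc in auto)
qed

text \<open>
  By the Leibniz rule the derivative in direction \<open>v\<close> is \<open>B (f x) (g' v) + B (f' v) (g x)\<close>, again a sum
  of bilinear expressions, now in functions that are one order less regular; hence the induction.
\<close>

lemma Ck_on_bilinear:
  assumes "open S" "bounded_bilinear B"
  shows "Ck_on n S f \<Longrightarrow> Ck_on n S g \<Longrightarrow> Ck_on n S (\<lambda>x. B (f x) (g x))"
proof (induction n arbitrary: f g)
  case 0
  then show ?case by (simp add: bounded_bilinear.continuous_on[OF assms(2)])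
next
  case (Suc n)
  have "Ck_on n S f" "Ck_on n S g"
    using Suc.prems Ck_on_SucD by blast+
  then show ?case
    using Suc.prems
    by (intro Ck_on_SucI[OF assms(1) bounded_bilinear.FDERIV[OF assms(2)
          Ck_on_has_derivative[OF Suc.prems(1)] Ck_on_has_derivative[OF Suc.prems(2)]]]
        Ck_on_add[OF assms(1)] Suc.IH) auto
qed

text \<open>
  The derivative \<open>- f\<inverse> f' f\<inverse>\<close> contains the inverse itself, but only at the lower order at which it is
  already known to be regular.
\<close>

lemma Ck_on_inverse:
  fixes f :: "'v::real_normed_vector \<Rightarrow> 'k::real_normed_field"
  assumes "open S" "\<And>x. x \<in> S \<Longrightarrow> f x \<noteq> 0"
  shows "Ck_on n S f \<Longrightarrow> Ck_on n S (\<lambda>x. inverse (f x))"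
proof (induction n)
  case 0
  then show ?case using assms(2) by (auto intro: continuous_on_inverse)
next
  case (Suc n)
  have inv: "Ck_on n S (\<lambda>x. inverse (f x))" using Suc Ck_on_SucD by blast
  show ?case
  proof (rule Ck_on_SucI[OF assms(1)])
    show "((\<lambda>x. inverse (f x)) has_derivative
        (\<lambda>v. - (inverse (f x) * frechet_derivative f (at x) v * inverse (f x)))) (at x)"
      if "x \<in> S" for x
      using Deriv.has_derivative_inverse[OF assms(2)[OF that] Ck_on_has_derivative[OF Suc.prems that]] .
    show "Ck_on n S (\<lambda>x. - (inverse (f x) * frechet_derivative f (at x) v * inverse (f x)))" for v
      using inv Suc.prems
      by (intro Ck_on_bounded_linear[OF assms(1) bounded_linear_minus[OF bounded_linear_ident]]
            Ck_on_bilinear[OF assms(1) bounded_bilinear_mult]) auto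
  qed
qed

lemma has_derivative_norm_at:
  fixes x :: "'v::real_inner"
  assumes "x \<noteq> 0"
  shows "(norm has_derivative (\<lambda>v. (x \<bullet> v) * inverse (norm x))) (at x)"
  using GDERIV_norm[OF assms] unfolding gderiv_def sgn_div_norm
  by (simp add: inner_commute mult.commute)

text \<open>
  Again the derivative \<open>(x \<bullet> v) / norm x\<close> contains the function itself, one order lower.
\<close>

lemma Ck_on_norm:
  "Ck_on n (UNIV - {0}) (norm :: 'v::real_inner \<Rightarrow> real)"
proof (induction n)
  case 0
  show ?case by (simp add: continuous_on_norm_id)
next
  case (Suc n)
  have o: "open (UNIV - {0 :: 'v})" by (simp add: open_delete)
  show ?case
    by (rule Ck_on_SucI[OF o has_derivative_norm_at])
      (auto intro!: Ck_on_bilinear[OF o bounded_bilinear_mult] Ck_on_inverse[OF o _ Suc]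
         Ck_on_bounded_linear[OF o bounded_linear_inner_left Ck_on_id[OF o]])
qed

lemma smooth_on_cong:
  "open S \<Longrightarrow> smooth_on S g \<Longrightarrow> (\<And>x. x \<in> S \<Longrightarrow> f x = g x) \<Longrightarrow> smooth_on S f"
  using Ck_on_cong[of S f g] by (simp add: smooth_on_def)

lemma smooth_on_const [simp]: "open S \<Longrightarrow> smooth_on S (\<lambda>x. k)"
  by (simp add: smooth_on_def Ck_on_const)

lemma smooth_on_bounded_linear:
  "open S \<Longrightarrow> bounded_linear L \<Longrightarrow> smooth_on S f \<Longrightarrow> smooth_on S (\<lambda>x. L (f x))"
  by (simp add: smooth_on_def Ck_on_bounded_linear)

lemma smooth_on_of_real:
  "open S \<Longrightarrow> smooth_on S f \<Longrightarrow> smooth_on S (\<lambda>x. of_real (f x) :: 'k::real_normed_field)"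
  by (rule smooth_on_bounded_linear[OF _ bounded_linear_of_real])

lemma smooth_on_id: "open S \<Longrightarrow> smooth_on S (\<lambda>x. x)"
  by (simp add: smooth_on_def Ck_on_id)

lemma smooth_on_add:
  "open S \<Longrightarrow> smooth_on S f \<Longrightarrow> smooth_on S g \<Longrightarrow> smooth_on S (\<lambda>x. f x + g x)"
  by (simp add: smooth_on_def Ck_on_add)

lemma smooth_on_mult:
  fixes f g :: "'v::real_normed_vector \<Rightarrow> 'k::real_normed_field"
  shows "open S \<Longrightarrow> smooth_on S f \<Longrightarrow> smooth_on S g \<Longrightarrow> smooth_on S (\<lambda>x. f x * g x)"
  by (simp add: smooth_on_def Ck_on_bilinear[OF _ bounded_bilinear_mult])

lemma smooth_on_diff:
  fixes f g :: "'v::real_normed_vector \<Rightarrow> 'k::real_normed_field"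
  shows "open S \<Longrightarrow> smooth_on S f \<Longrightarrow> smooth_on S g \<Longrightarrow> smooth_on S (\<lambda>x. f x - g x)"
  using smooth_on_add[of S f "\<lambda>x. - g x"] 
    smooth_on_bounded_linear[OF _ bounded_linear_minus[OF bounded_linear_ident], of S g] by simp

lemma smooth_on_divide:
  fixes f g :: "'v::real_normed_vector \<Rightarrow> 'k::real_normed_field"
  shows "open S \<Longrightarrow> smooth_on S f \<Longrightarrow> smooth_on S g \<Longrightarrow> (\<And>x. x \<in> S \<Longrightarrow> g x \<noteq> 0)
    \<Longrightarrow> smooth_on S (\<lambda>x. f x / g x)"
  using smooth_on_mult[of S f "\<lambda>x. inverse (g x)"] 
  by (simp add: smooth_on_def Ck_on_inverse divide_inverse)

lemma smooth_on_has_vector_derivative: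
  assumes "smooth_on S g" "s \<in> S"
  shows "(g has_vector_derivative vector_derivative g (at s)) (at s)"
proof -
  have "Ck_on (Suc 0) S g" using assms(1) unfolding smooth_on_def by blast
  then show ?thesis using assms(2) by (simp add: vector_derivative_works[symmetric])
qed

lemma frechet_derivative_eq_scaleR_vector_derivative:
  assumes "smooth_on S g" "s \<in> S"
  shows "frechet_derivative g (at s) v = v *\<^sub>R vector_derivative g (at s)"
  using frechet_derivative_at[OF smooth_on_has_vector_derivative[OF assms, unfolded has_vector_derivative_def]]
  by metis

lemma smooth_on_vector_derivative:
  assumes "open S" "smooth_on S g"
  shows "smooth_on S (\<lambda>s. vector_derivative g (at s))"
proof (rule smooth_on_cong[OF assms(1)])
  show "smooth_on S (\<lambda>s. frechet_derivative g (at s) 1)"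
    unfolding smooth_on_def
  proof
    fix n
    have "Ck_on (Suc n) S g" using assms(2) unfolding smooth_on_def by blast
    then show "Ck_on n S (\<lambda>s. frechet_derivative g (at s) 1)" by simp
  qed
qed (simp add: frechet_derivative_eq_scaleR_vector_derivative[OF assms(2)])

lemma has_derivative_radial:
  fixes x :: "'v::real_inner"
  assumes "smooth_on {0<..} g" "x \<noteq> 0"
  shows "((\<lambda>y. g (norm y)) has_derivative
    (\<lambda>v. ((x \<bullet> v) * inverse (norm x)) *\<^sub>R vector_derivative g (at (norm x)))) (at x)"
proof -
  have "(g has_derivative (\<lambda>u. u *\<^sub>R vector_derivative g (at (norm x)))) (at (norm x))"
    using smooth_on_has_vector_derivative[OF assms(1), of "norm x"] assms(2)
    by (simp add: has_vector_derivative_def)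
  from has_derivative_compose[OF has_derivative_norm_at[OF assms(2)] this]
  show ?thesis .
qed

text \<open>
  The gradient of \<open>g \<circ> norm\<close> is \<open>g'(norm x)\<close> times the gradient of the norm, so the induction runs over
  all profiles \<open>g\<close> at once and passes from \<open>g\<close> to \<open>g'\<close>.
\<close>

lemma smooth_on_radial:
  fixes g :: "real \<Rightarrow> 'b::real_normed_vector"
  assumes "smooth_on {0<..} g"
  shows "smooth_on (UNIV - {0}) (\<lambda>x::'v::real_inner. g (norm x))"
  unfolding smooth_on_def
proof
  fix n
  have o: "open (UNIV - {0 :: 'v})" by (simp add: open_delete)
  show "Ck_on n (UNIV - {0}) (\<lambda>x::'v. g (norm x))"
    using assms
  proof (induction n arbitrary: g)
    case 0
    have "Ck_on 0 {0<..} g" using 0 unfolding smooth_on_def by blast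
    then have "continuous_on {0<..} g" by simp
    then have "continuous_on (UNIV - {0}) (\<lambda>x::'v. g (norm x))"
      by (rule continuous_on_compose2) (auto intro: continuous_on_norm_id)
    then show ?case by simp
  next
    case (Suc n)
    have "Ck_on n (UNIV - {0}) (\<lambda>x::'v. vector_derivative g (at (norm x)))"
      by (rule Suc.IH[OF smooth_on_vector_derivative[OF _ Suc.prems]]) simp
    moreover have "Ck_on n (UNIV - {0}) (\<lambda>x::'v. x \<bullet> v)" for v
      using smooth_on_bounded_linear[OF o bounded_linear_inner_left smooth_on_id[OF o]]
      unfolding smooth_on_def by blast
    moreover have "Ck_on n (UNIV - {0}) (\<lambda>x::'v. inverse (norm x))"
      by (rule Ck_on_inverse[OF o _ Ck_on_norm]) simp
    ultimately show ?case
      by (intro Ck_on_SucI[OF o has_derivative_radial[OF Suc.prems]]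
          Ck_on_bilinear[OF o bounded_bilinear_scaleR] Ck_on_bilinear[OF o bounded_bilinear_mult]) simp_all
  qed
qed

section \<open>Partial derivatives and the metric in Cartesian coordinates\<close>

lemma pd_eq:
  assumes "(a has_derivative a') (at x)"
  shows "pd i a x = a' (axis i 1)"
  unfolding pd_def using frechet_derivative_at[OF assms] by simp

lemma pd_cong:
  assumes "open S" "x \<in> S" "\<And>y. y \<in> S \<Longrightarrow> a y = b y"
  shows "pd i a x = pd i b x"
  unfolding pd_def using frechet_derivative_cong_open[OF assms] by simp

lemma vf_apply_cong:
  assumes "open S" "x \<in> S" "\<And>y. y \<in> S \<Longrightarrow> a y = b y"
  shows "vf_apply X a x = vf_apply X b x"
  unfolding vf_apply_def using pd_cong[OF assms] by simp

lemma lie_form_cong: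
  assumes "open S" "x \<in> S" "\<And>y. y \<in> S \<Longrightarrow> \<omega> y = \<eta> y"
  shows "lie_form X \<omega> x = lie_form X \<eta> x"
proof -
  have "vf_apply X (\<lambda>y. \<omega> y $ i) x = vf_apply X (\<lambda>y. \<eta> y $ i) x" for i
    by (rule vf_apply_cong[OF assms(1,2)]) (simp add: assms(3))
  then show ?thesis by (simp add: lie_form_def assms(2,3))
qed

lemma pd_cfun:
  assumes "a differentiable at x"
  shows "pd i (cfun a :: _ \<Rightarrow> 'k::real_normed_field) x = of_real (pd i a x)"
proof -
  obtain a' where a': "(a has_derivative a') (at x)" using assms by (auto simp: differentiable_def)
  have "((cfun a :: _ \<Rightarrow> 'k) has_derivative (\<lambda>v. of_real (a' v))) (at x)"
    unfolding cfun_def by (rule bounded_linear.has_derivative[OF bounded_linear_of_real a'])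
  then show ?thesis using pd_eq[OF a', of i] pd_eq by metis
qed

lemma vf_apply_cfun:
  assumes "a differentiable at x"
  shows "vf_apply X (cfun a :: _ \<Rightarrow> 'k::real_normed_field) x = of_real (vf_apply X a x)"
  by (simp add: vf_apply_def pd_cfun[OF assms] scaleR_conv_of_real)

lemma dcl_cfun:
  assumes "a differentiable at x"
  shows "dcl (cfun a :: _ \<Rightarrow> 'k::real_normed_field) x = cform (dcl a) x"
  by (simp add: dcl_def cform_def pd_cfun[OF assms] vec_eq_iff)

text \<open>
  The inverse metric is real, so the pairing of real forms may be computed before extending scalars.
\<close>

lemma ip_of_real:
  fixes \<omega> \<eta> :: "('k::real_normed_field, 'n::finite) form"
  assumes "\<omega> x = cform \<omega>' x" "\<eta> x = cform \<eta>' x"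
  shows "ip g \<omega> \<eta> x = of_real (ip g \<omega>' \<eta>' x)"
  by (simp add: ip_def assms cform_def scaleR_conv_of_real)

lemma ip_eq_inner: "ip g \<omega> \<eta> x = \<omega> x \<bullet> (matrix_inv (g x) *v \<eta> x)" for \<omega> \<eta> :: "(real, 'n::finite) form"
  by (simp add: ip_def inner_vec_def matrix_vector_mult_def sum_distrib_left mult_ac)

lemma open_punctured: "open punctured_space"
  by (simp add: punctured_space_def open_delete)

lemma pd_coord: "pd i (\<lambda>y::real^'n. y $ j) x = (if i = j then 1 else 0)"
  using pd_eq[OF bounded_linear_imp_has_derivative[OF bounded_linear_vec_nth[of j]], of i x]
  by (simp add: axis_def)

lemma dcl_coord: "dcl (\<lambda>y::real^'n. y $ j) x = axis j 1"
  by (auto simp: dcl_def pd_coord vec_eq_iff axis_def)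

lemma has_derivative_coord_radial:
  fixes x :: "real^'n"
  assumes "smooth_on {0<..} u" "x \<noteq> 0"
  shows "((\<lambda>y. (y $ j) *\<^sub>R u (norm y)) has_derivative
    (\<lambda>v. (x $ j * (x \<bullet> v) / norm x) *\<^sub>R vector_derivative u (at (norm x)) + (v $ j) *\<^sub>R u (norm x))) (at x)"
  using has_derivative_scaleR[OF bounded_linear_imp_has_derivative[OF bounded_linear_vec_nth[of j]]
     has_derivative_radial[OF assms]]
  by (simp add: divide_inverse mult_ac)

lemma pd_radial:
  fixes x :: "real^'n"
  assumes "smooth_on {0<..} u" "x \<noteq> 0"
  shows "pd i (\<lambda>y. u (norm y)) x = (x $ i / norm x) *\<^sub>R vector_derivative u (at (norm x))"
  using pd_eq[OF has_derivative_radial[OF assms], of i] by (simp add: inner_axis divide_inverse)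

lemma pd_coord_radial:
  fixes x :: "real^'n"
  assumes "smooth_on {0<..} u" "x \<noteq> 0"
  shows "pd i (\<lambda>y. (y $ j) *\<^sub>R u (norm y)) x =
    (x $ j * x $ i / norm x) *\<^sub>R vector_derivative u (at (norm x)) + (if i = j then u (norm x) else 0)"
  using pd_eq[OF has_derivative_coord_radial[OF assms], of i]
  by (simp add: inner_axis) (simp add: axis_def)

lemma dcl_norm: "x \<noteq> 0 \<Longrightarrow> dcl norm x = (1 / norm x) *\<^sub>R x" for x :: "real^'n"
  using pd_eq[OF has_derivative_norm_at, of x] by (simp add: dcl_def vec_eq_iff inner_axis divide_inverse)

lemma sum_coord_sq: "(\<Sum>i\<in>UNIV. x $ i * x $ i) = (norm x)\<^sup>2" for x :: "real^'n"
  by (simp add: power2_norm_eq_inner inner_vec_def)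

text \<open>
  The identity stretched by the factor \<open>p\<close> along the radial direction.  The metric at \<open>x\<close> is the case
  \<open>p = h(r)\<^sup>2\<close>, its inverse the case \<open>p = 1 / h(r)\<^sup>2\<close>, and the tangential projection \<open>e\<close> the case \<open>p = 0\<close>.
\<close>

definition radial_matrix :: "real \<Rightarrow> real^'n \<Rightarrow> real^'n^'n" where
  "radial_matrix p x = (\<chi> a b. (if a = b then 1 else 0) + (p - 1) * (x $ a * x $ b) / (norm x)\<^sup>2)"

lemma radial_matrix_apply:
  "radial_matrix p x *v w = w + ((p - 1) * (x \<bullet> w) / (norm x)\<^sup>2) *\<^sub>R x"
proof (rule vec_eq_iff[THEN iffD2, rule_format])
  fix a
  have "(radial_matrix p x *v w) $ a =
      (\<Sum>b\<in>UNIV. (if a = b then w $ b else 0) + (p - 1) * x $ a / (norm x)\<^sup>2 * (x $ b * w $ b))"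
    unfolding matrix_vector_mult_def radial_matrix_def
    by (auto intro!: sum.cong simp: algebra_simps)
  also have "\<dots> = w $ a + (p - 1) * x $ a / (norm x)\<^sup>2 * (x \<bullet> w)"
    by (simp add: sum.distrib inner_vec_def sum_distrib_left sum_divide_distrib)
  finally show "(radial_matrix p x *v w) $ a = (w + ((p - 1) * (x \<bullet> w) / (norm x)\<^sup>2) *\<^sub>R x) $ a"
    by (simp add: mult_ac)
qed

text \<open>
  All these matrices act as the identity on tangential vectors and by a scalar on radial ones.
\<close>

lemma radial_matrix_mult:
  assumes "x \<noteq> 0"
  shows "radial_matrix p x ** radial_matrix q x = radial_matrix (p * q) x"
proof -
  have "(p - 1) * (x \<bullet> (w + ((q - 1) * (x \<bullet> w) / (norm x)\<^sup>2) *\<^sub>R x)) / (norm x)\<^sup>2 + 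
     (q - 1) * (x \<bullet> w) / (norm x)\<^sup>2 = (p * q - 1) * (x \<bullet> w) / (norm x)\<^sup>2" for w
    using assms by (simp add: inner_add_right power2_norm_eq_inner field_simps)
  then show ?thesis
    unfolding matrix_eq matrix_vector_mul_assoc[symmetric] radial_matrix_apply
    by (simp add: add.assoc flip: scaleR_add_left) (simp add: add.commute)
qed

lemma radial_matrix_1: "radial_matrix 1 x = mat 1"
  by (simp add: radial_matrix_def mat_def)

lemma matrix_inv_eqI:
  fixes A :: "real^'n^'m"
  assumes "A ** B = mat 1" "B ** A = mat 1"
  shows "matrix_inv A = B"
proof -
  have "A ** matrix_inv A = mat 1 \<and> matrix_inv A ** A = mat 1"
    unfolding matrix_inv_def by (rule someI[of _ B]) (simp add: assms)
  then have "matrix_inv A = (B ** A) ** matrix_inv A" "B ** (A ** matrix_inv A) = B"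
    using assms by simp_all
  then show ?thesis by (simp add: matrix_mul_assoc)
qed

lemma matrix_inv_radial_matrix:
  assumes "x \<noteq> 0" "p \<noteq> 0"
  shows "matrix_inv (radial_matrix p x) = radial_matrix (1 / p) x"
proof -
  have "radial_matrix p x ** radial_matrix (1 / p) x = mat 1"
    "radial_matrix (1 / p) x ** radial_matrix p x = mat 1"
    using assms by (simp_all add: radial_matrix_mult radial_matrix_1)
  then show ?thesis by (rule matrix_inv_eqI)
qed

lemma det_radial_matrix:
  fixes x :: "real^3"
  assumes "x \<noteq> 0"
  shows "det (radial_matrix p x) = p"
proof -
  have n: "(norm x)\<^sup>2 = x $ 1 * x $ 1 + x $ 2 * x $ 2 + x $ 3 * x $ 3"
    by (simp add: sum_3 flip: sum_coord_sq)
  have "det (radial_matrix p x) = 1 + (p - 1) * (x $ 1 * x $ 1 + x $ 2 * x $ 2 + x $ 3 * x $ 3) / (norm x)\<^sup>2"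
    by (simp add: det_3 radial_matrix_def) (simp add: algebra_simps add_divide_distrib diff_divide_distrib)
  then show ?thesis using assms by (simp flip: n)
qed

lemma omega_nth: "omega i x $ a = proj_e i a x"
  by (simp add: omega_def dcl_coord axis_def if_distrib cong: if_cong)

lemma proj_e_eq: "proj_e i j x = radial_matrix 0 x $ i $ j"
  by (simp add: proj_e_def radial_matrix_def)

lemma proj_e_sym: "proj_e i j x = proj_e j i x"
  by (simp add: proj_e_def mult.commute)

text \<open>
  The tangential part \<open>\<omega>\<^sub>i \<otimes> \<omega>\<^sub>i\<close> has the matrix \<open>e\<^sup>T e = e\<close>, because \<open>e\<close> is a symmetric projection.
\<close>

lemma spatial_metric_eq:
  assumes "x \<noteq> 0"
  shows "spatial_metric h x = radial_matrix ((h (norm x))\<^sup>2) x"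
proof -
  have "(\<Sum>i\<in>UNIV. proj_e i a x * proj_e i b x) = (radial_matrix 0 x ** radial_matrix 0 x) $ a $ b" for a b
    unfolding proj_e_sym[of _ a] by (simp add: matrix_matrix_mult_def proj_e_eq)
  then have "(\<Sum>i\<in>UNIV. proj_e i a x * proj_e i b x) = proj_e a b x" for a b
    using assms by (simp add: radial_matrix_mult proj_e_eq)
  then show ?thesis
    using assms by (simp add: spatial_metric_def radial_matrix_def omega_nth vec_eq_iff dcl_norm
        proj_e_def field_simps power2_eq_square)
qed

lemma vol_spatial_metric: "x \<noteq> 0 \<Longrightarrow> vol (spatial_metric h) x = \<bar>h (norm x)\<bar>"
  by (simp add: vol_def spatial_metric_eq det_radial_matrix)

lemma matrix_inv_spatial_metric:
  "x \<noteq> 0 \<Longrightarrow> h (norm x) \<noteq> 0 \<Longrightarrow>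
    matrix_inv (spatial_metric h x) = radial_matrix (1 / (h (norm x))\<^sup>2) x"
  by (simp add: spatial_metric_eq matrix_inv_radial_matrix)

lemma radial_matrix_self: "x \<noteq> 0 \<Longrightarrow> radial_matrix p x *v x = p *\<^sub>R x"
  by (simp add: radial_matrix_apply power2_norm_eq_inner flip: scaleR_add_left)
    (simp add: algebra_simps)

lemma inner_omega_self: "x \<noteq> 0 \<Longrightarrow> x \<bullet> omega i x = 0"
proof -
  assume "x \<noteq> 0"
  have "x \<bullet> omega i x = (radial_matrix 0 x *v x) $ i"
    by (simp add: inner_vec_def omega_nth proj_e_eq matrix_vector_mult_def mult.commute)
  then show ?thesis using \<open>x \<noteq> 0\<close> by (simp add: radial_matrix_self)
qed

lemma ip_spatial_metric:
  fixes \<omega> \<eta> :: "(real, 3) form"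
  assumes "x \<noteq> 0" "h (norm x) \<noteq> 0"
  shows "ip (spatial_metric h) \<omega> \<eta> x =
    \<omega> x \<bullet> \<eta> x + (1 / (h (norm x))\<^sup>2 - 1) * (x \<bullet> \<eta> x) * (x \<bullet> \<omega> x) / (norm x)\<^sup>2"
  using assms by (simp add: ip_eq_inner matrix_inv_spatial_metric radial_matrix_apply
      inner_add_right inner_commute)

section \<open>The radial conformal field\<close>


lemma radial_tau_eq: "radial_tau h x = (1 / h (norm x)) *\<^sub>R x"
  by (cases "x = 0") (simp_all add: radial_tau_def d_dr_def)

text \<open>
  Since \<open>\<tau> = x / h(r)\<close>, the field \<open>\<tau>\<close> is \<open>1 / h(r)\<close> times the Euler field, and applying it to a function
  is differentiating in the direction \<open>x\<close>.
\<close>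

lemma vf_apply_radial_tau:
  assumes "(a has_derivative a') (at x)"
  shows "vf_apply (radial_tau h) a x = (1 / h (norm x)) *\<^sub>R a' x"
proof -
  interpret bounded_linear a' using assms by (rule has_derivative_bounded_linear)
  have "a' x = a' (\<Sum>i\<in>UNIV. (x $ i) *\<^sub>R axis i 1)"
    using basis_expansion[of x] by (simp add: scalar_mult_eq_scaleR)
  also have "\<dots> = (\<Sum>i\<in>UNIV. (x $ i) *\<^sub>R a' (axis i 1))"
    by (simp add: sum scaleR)
  finally have "a' x = \<dots>" .
  then show ?thesis
    by (simp add: vf_apply_def pd_eq[OF assms] radial_tau_eq scaleR_sum_right divide_inverse mult.commute)
qed

lemma vf_apply_radial_tau_radial:
  fixes u :: "real \<Rightarrow> 'b::real_normed_field"
  assumes "smooth_on {0<..} u" "x \<noteq> 0"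
  shows "vf_apply (radial_tau h) (\<lambda>y. u (norm y)) x =
    (norm x / h (norm x)) *\<^sub>R vector_derivative u (at (norm x))"
  using vf_apply_radial_tau[OF has_derivative_radial[OF assms], of h] assms(2)
  by (simp flip: power2_norm_eq_inner) (simp add: power2_eq_square)

lemma has_derivative_quadratic_radial:
  fixes q :: "real \<Rightarrow> real" and x :: "real^'n"
  assumes "smooth_on {0<..} q" "x \<noteq> 0"
  shows "((\<lambda>y. k + y $ i * y $ j * q (norm y)) has_derivative
    (\<lambda>v. x $ i * x $ j * ((x \<bullet> v) / norm x * vector_derivative q (at (norm x)))
      + (x $ i * v $ j + v $ i * x $ j) * q (norm x))) (at x)"
  using has_derivative_add[OF has_derivative_const has_derivative_mult[OF
     has_derivative_mult[OF bounded_linear_imp_has_derivative[OF bounded_linear_vec_nth[of i]]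
      bounded_linear_imp_has_derivative[OF bounded_linear_vec_nth[of j]]] has_derivative_radial[OF assms]], of k]
  by (simp add: divide_inverse)

text \<open>
  The entries of the metric (\<open>q = (h\<^sup>2 - 1) / r\<^sup>2\<close>) and of the projection \<open>e\<close> (\<open>q = - 1 / r\<^sup>2\<close>) both have
  this shape.  For the second one the bracket vanishes, as it must for a function of degree 0.
\<close>

lemma vf_apply_radial_tau_quadratic:
  fixes q :: "real \<Rightarrow> real"
  assumes "smooth_on {0<..} q" "x \<noteq> 0"
  shows "vf_apply (radial_tau h) (\<lambda>y. k + y $ i * y $ j * q (norm y)) x =
    (x $ i * x $ j / h (norm x)) * (2 * q (norm x) + norm x * vector_derivative q (at (norm x)))"
  using vf_apply_radial_tau[OF has_derivative_quadratic_radial[OF assms, of k i j], of h] assms(2)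
  by (simp add: power2_norm_eq_inner[symmetric] power2_eq_square algebra_simps)

lemma smooth_on_ident: "smooth_on {0<..} (\<lambda>s::real. s)"
  by (rule smooth_on_id) simp

lemma vector_derivative_eqI: "(q has_real_derivative D) (at s) \<Longrightarrow> vector_derivative q (at s) = D"
  by (simp add: has_real_derivative_iff_has_vector_derivative vector_derivative_at)

lemma smooth_on_has_real_derivative:
  "smooth_on S q \<Longrightarrow> s \<in> S \<Longrightarrow> (q has_real_derivative vector_derivative q (at s)) (at s)" for q :: "real \<Rightarrow> real"
  by (simp add: has_real_derivative_iff_has_vector_derivative smooth_on_has_vector_derivative)

locale radial_lapse =
  fixes h :: "real \<Rightarrow> real"
  assumes smooth_h: "smooth_on {0<..} h"
    and h_nonzero: "s > 0 \<Longrightarrow> h s \<noteq> 0"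
begin

lemma smooth_inverse_h: "smooth_on {0<..} (\<lambda>s. 1 / h s)"
  by (intro smooth_on_divide smooth_on_const smooth_h) (auto simp: h_nonzero)

lemma pd_radial_tau:
  assumes "x \<noteq> 0"
  shows "pd i (\<lambda>y. radial_tau h y $ j) x =
    (x $ j * x $ i / norm x) * vector_derivative (\<lambda>s. 1 / h s) (at (norm x)) + (if i = j then 1 / h (norm x) else 0)"
  using pd_coord_radial[OF smooth_inverse_h assms, of i j] by (simp add: radial_tau_eq mult.commute)

text \<open>
  The Jacobian of \<open>\<tau>\<close> contracted with a covector, the zeroth-order term of every Lie derivative along
  \<open>\<tau>\<close>.  On covectors orthogonal to \<open>x\<close> it is multiplication by \<open>1 / h\<close>.
\<close>

lemma sum_pd_radial_tau:
  fixes v :: "real^3"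
  assumes "x \<noteq> 0"
  shows "(\<Sum>j\<in>UNIV. pd i (\<lambda>y. radial_tau h y $ j) x * v $ j) =
    (x \<bullet> v) * (x $ i / norm x) * vector_derivative (\<lambda>s. 1 / h s) (at (norm x)) + v $ i / h (norm x)"
proof -
  have "(\<Sum>j\<in>UNIV. pd i (\<lambda>y. radial_tau h y $ j) x * v $ j) =
     (\<Sum>j\<in>UNIV. (x $ j * v $ j) * (x $ i / norm x * vector_derivative (\<lambda>s. 1 / h s) (at (norm x)))
        + (if i = j then v $ j / h (norm x) else 0))"
    by (intro sum.cong) (auto simp: pd_radial_tau[OF assms] algebra_simps)
  then show ?thesis
    by (simp add: sum.distrib inner_vec_def sum_distrib_right sum_divide_distrib mult.assoc)
qed

lemma vector_derivative_inverse_h: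
  assumes "s > 0"
  shows "vector_derivative (\<lambda>s. 1 / h s) (at s) = - vector_derivative h (at s) / (h s)\<^sup>2"
  using assms h_nonzero smooth_on_has_real_derivative[OF smooth_h, of s]
  by (intro vector_derivative_eqI) (auto intro!: derivative_eq_intros simp: power2_eq_square)

text \<open>
  Both \<open>h dr\<close> and the round part scale alike: \<open>\<tau>(r) = r / h\<close>, and the derivative of \<open>h\<close> that comes from
  differentiating the coefficient \<open>h\<^sup>2\<close> cancels against the one in \<open>L\<^sub>\<tau> dr = d (r / h)\<close>.
\<close>

lemma lie_metric_radial_tau:
  assumes "x \<noteq> 0"
  shows "lie_metric (radial_tau h) (spatial_metric h) x = (2 / h (norm x)) *\<^sub>R spatial_metric h x"
proof (intro vec_eq_iff[THEN iffD2, rule_format])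
  fix a b
  define r where "r = norm x"
  define h' where "h' = vector_derivative h (at r)"
  have r: "r > 0" and hr: "h r \<noteq> 0" using assms h_nonzero by (auto simp: r_def)
  let ?q = "\<lambda>s. ((h s)\<^sup>2 - 1) / s\<^sup>2"
  have q: "smooth_on {0<..} ?q"
    unfolding power2_eq_square
    by (intro smooth_on_divide smooth_on_diff smooth_on_mult smooth_h smooth_on_const smooth_on_ident) auto
  have q': "vector_derivative ?q (at r) = 2 * h r * h' / r\<^sup>2 - 2 * ((h r)\<^sup>2 - 1) / r ^ 3"
    using r smooth_on_has_real_derivative[OF smooth_h, of r]
    by (intro vector_derivative_eqI)
      (auto intro!: derivative_eq_intros simp: h'_def field_simps power2_eq_square power3_eq_cube)
  have g: "spatial_metric h y $ a $ b = (if a = b then 1 else 0) + y $ a * y $ b * ?q (norm y)"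
    if "y \<in> punctured_space" for y a b
    using that by (simp add: punctured_space_def spatial_metric_eq radial_matrix_def)
  have 1: "vf_apply (radial_tau h) (\<lambda>y. spatial_metric h y $ a $ b) x =
      (x $ a * x $ b / h r) * (2 * ?q r + r * (2 * h r * h' / r\<^sup>2 - 2 * ((h r)\<^sup>2 - 1) / r ^ 3))"
    using vf_apply_cong[OF open_punctured, OF _ g] vf_apply_radial_tau_quadratic[OF q assms] assms q'
    by (simp add: punctured_space_def r_def)
  have row: "x \<bullet> spatial_metric h x $ a = (h r)\<^sup>2 * x $ a" for a
    using radial_matrix_self[OF assms, of "(h r)\<^sup>2"] 
    by (simp add: spatial_metric_eq[OF assms] flip: r_def)
      (simp add: vec_eq_iff matrix_vector_mult_def inner_vec_def mult.commute)
  have sym: "spatial_metric h x $ k $ a = spatial_metric h x $ a $ k" for k a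
    by (auto simp: spatial_metric_eq[OF assms] radial_matrix_def mult.commute)
  have 2: "(\<Sum>k\<in>UNIV. spatial_metric h x $ a $ k * pd b (\<lambda>y. radial_tau h y $ k) x) =
    - (x $ a * x $ b / r) * h' + spatial_metric h x $ a $ b / h r" for a b
    using sum_pd_radial_tau[OF assms, of b "spatial_metric h x $ a"] hr
      vector_derivative_inverse_h[OF r]
    by (simp add: row h'_def mult.commute flip: r_def)
  have "(\<Sum>k\<in>UNIV. spatial_metric h x $ k $ b * pd a (\<lambda>y. radial_tau h y $ k) x) =
      (\<Sum>k\<in>UNIV. spatial_metric h x $ b $ k * pd a (\<lambda>y. radial_tau h y $ k) x)"
    by (intro sum.cong) (simp_all only: sym[of _ b])
  then have 3: "(\<Sum>k\<in>UNIV. spatial_metric h x $ k $ b * pd a (\<lambda>y. radial_tau h y $ k) x) =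
    - (x $ a * x $ b / r) * h' + spatial_metric h x $ a $ b / h r"
    using 2[of b a] sym[of b a] by (simp add: mult.commute)
  \<comment> \<open>the coefficients contribute exactly what cancels the derivative of \<open>1 / h\<close> in both Jacobian terms\<close>
  have "(x $ a * x $ b / h r) * (2 * ?q r + r * (2 * h r * h' / r\<^sup>2 - 2 * ((h r)\<^sup>2 - 1) / r ^ 3)) =
      2 * (x $ a * x $ b / r) * h'"
    using r hr by (simp add: field_simps power2_eq_square power3_eq_cube)
  then show "lie_metric (radial_tau h) (spatial_metric h) x $ a $ b =
      ((2 / h (norm x)) *\<^sub>R spatial_metric h x) $ a $ b"
    unfolding lie_metric_def vec_lambda_beta 1 2 3 by (simp add: r_def)
qed

lemma conformal_killing_radial_tau:
  "conformal_killing punctured_space (spatial_metric h) (radial_tau h)"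
  unfolding conformal_killing_def
proof (intro exI conjI ballI)
  have "smooth_on {0<..} (\<lambda>s. 2 / h s)"
    by (intro smooth_on_divide smooth_on_const smooth_h) (auto simp: h_nonzero)
  from smooth_on_radial[OF this]
  show "smooth_on punctured_space (\<lambda>x. 2 / h (norm x))" unfolding punctured_space_def .
qed (simp add: punctured_space_def lie_metric_radial_tau)

text \<open>
  The volume density is \<open>\<bar>h\<bar>\<close>.  By connectedness of the half-line \<open>h\<close> has a constant sign, so the density
  is smooth, and the sign cancels in the divergence and in the Laplacian.
\<close>

lemma abs_h: obtains \<sigma> where "\<sigma> * \<sigma> = 1" "\<And>s. s > 0 \<Longrightarrow> \<bar>h s\<bar> = \<sigma> * h s"
proof -
  have cont: "continuous_on {0<..} h"
    using smooth_h unfolding smooth_on_def by (metis Ck_on.simps(1))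
  then have "connected (h ` {0<..})" by (intro connected_continuous_image) auto
  then have "0 \<in> h ` {0<..}" if "a > 0" "b > 0" "h a \<le> 0" "h b \<ge> 0" for a b
    using that unfolding connected_iff_interval by blast
  then have nn: "\<not> (a > 0 \<and> b > 0 \<and> h a \<le> 0 \<and> h b \<ge> 0)" for a b
    using h_nonzero by force
  show thesis
  proof (cases "h 1 > 0")
    case True
    then have "\<bar>h s\<bar> = 1 * h s" if "s > 0" for s using nn[of s 1] that by auto
    then show ?thesis using that[of 1] by simp
  next
    case False
    then have "\<bar>h s\<bar> = - 1 * h s" if "s > 0" for s using nn[of 1 s] that by auto
    then show ?thesis using that[of "-1"] by simp
  qed
qed

text \<open>
  The density cancels the denominator of \<open>\<tau> = x / h\<close> up to the sign \<open>\<sigma>\<close>, so the divergence is that of the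
  linear field \<open>\<sigma> x\<close> divided by \<open>\<sigma> h\<close>, namely \<open>3 / h\<close>.
\<close>

lemma alpha_radial:
  assumes "x \<noteq> 0"
  shows "alpha (spatial_metric h) (radial_tau h) x = 2 / h (norm x) - 1"
proof -
  obtain \<sigma> where \<sigma>: "\<sigma> * \<sigma> = 1" "\<And>s. s > 0 \<Longrightarrow> \<bar>h s\<bar> = \<sigma> * h s" using abs_h by blast
  have "vol (spatial_metric h) y * radial_tau h y $ i = \<sigma> *\<^sub>R y $ i" if "y \<in> punctured_space" for y i
    using that h_nonzero by (simp add: punctured_space_def vol_spatial_metric \<sigma> radial_tau_eq)
  then have "pd i (\<lambda>y. vol (spatial_metric h) y * radial_tau h y $ i) x = pd i (\<lambda>y. \<sigma> *\<^sub>R y $ i) x" for i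
    using assms by (intro pd_cong[OF open_punctured]) (auto simp: punctured_space_def)
  also have "pd i (\<lambda>y. \<sigma> *\<^sub>R y $ i) x = \<sigma>" for i
    using pd_eq[OF has_derivative_scaleR_right[OF bounded_linear_imp_has_derivative[OF bounded_linear_vec_nth[of i]], of \<sigma>], of i x]
    by (simp add: axis_def)
  moreover have "\<sigma> \<noteq> 0" using \<sigma>(1) by auto
  ultimately show ?thesis
    using assms h_nonzero[of "norm x"] by (simp add: alpha_def divergence_def vol_spatial_metric \<sigma>)
qed

text \<open>
  The components \<open>e\<^sub>i\<^sub>a\<close> are homogeneous of degree 0 and so are killed by \<open>\<tau>\<close>; as \<open>\<omega>\<^sub>i\<close> is orthogonal to \<open>x\<close>,
  the Jacobian of \<open>\<tau>\<close> only contributes the factor \<open>1 / h\<close>.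
\<close>

lemma lie_form_radial_tau_omega:
  assumes "x \<noteq> 0"
  shows "lie_form (radial_tau h) (cform (omega i) :: ('k::real_normed_field, 3) form) x =
    cfun (\<lambda>x. 1 / h (norm x)) x *s cform (omega i) x"
proof (intro vec_eq_iff[THEN iffD2, rule_format])
  fix a
  have q: "smooth_on {0<..} (\<lambda>s::real. - 1 / s\<^sup>2)"
    unfolding power2_eq_square by (intro smooth_on_divide smooth_on_mult smooth_on_const smooth_on_ident) auto
  have q': "vector_derivative (\<lambda>s::real. - 1 / s\<^sup>2) (at (norm x)) = 2 / (norm x) ^ 3"
    using assms by (intro vector_derivative_eqI) (auto intro!: derivative_eq_intros simp: field_simps power2_eq_square power3_eq_cube)
  have e: "proj_e i a = (\<lambda>y. (if i = a then 1 else 0) + y $ i * y $ a * (- 1 / (norm y)\<^sup>2))"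
    by (auto simp: proj_e_def)
  have "proj_e i a differentiable at x"
    unfolding e differentiable_def using has_derivative_quadratic_radial[OF q assms] by blast
  then have "vf_apply (radial_tau h) (\<lambda>y. of_real (proj_e i a y) :: 'k) x = of_real (vf_apply (radial_tau h) (proj_e i a) x)"
    using vf_apply_cfun by (simp add: cfun_def)
  also have "vf_apply (radial_tau h) (proj_e i a) x = 0"
    unfolding e vf_apply_radial_tau_quadratic[OF q assms] q'
    using assms by (simp add: power2_eq_square power3_eq_cube)
  finally have 1: "vf_apply (radial_tau h) (\<lambda>y. of_real (proj_e i a y) :: 'k) x = 0" by simp
  have "(\<Sum>j\<in>UNIV. pd a (\<lambda>y. radial_tau h y $ j) x *\<^sub>R (of_real (omega i x $ j) :: 'k)) =
     of_real (\<Sum>j\<in>UNIV. pd a (\<lambda>y. radial_tau h y $ j) x * omega i x $ j)"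
    by (simp add: scaleR_conv_of_real)
  also have "\<dots> = of_real (omega i x $ a / h (norm x))"
    using assms by (simp add: sum_pd_radial_tau inner_omega_self del: of_real_sum)
  finally show "lie_form (radial_tau h) (cform (omega i) :: ('k, 3) form) x $ a =
      (cfun (\<lambda>x. 1 / h (norm x)) x *s cform (omega i) x) $ a"
    using 1 by (simp add: lie_form_def cform_def cfun_def omega_nth)
qed

text \<open>
  Only the direction of the result matters: it makes the pairing with the \<open>\<omega>\<^sub>i\<close> vanish.
\<close>

lemma lie_form_radial_tau_radial:
  fixes z :: "real \<Rightarrow> real"
  assumes "smooth_on {0<..} z" "x \<noteq> 0"
  shows "\<exists>w. lie_form (radial_tau h) (\<lambda>y. z (norm y) *\<^sub>R y) x = w *\<^sub>R x"
proof -
  let ?z' = "vector_derivative z (at (norm x))"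
  let ?k' = "vector_derivative (\<lambda>s. 1 / h s) (at (norm x))"
  have 1: "vf_apply (radial_tau h) (\<lambda>y. (z (norm y) *\<^sub>R y) $ a) x =
     (1 / h (norm x) * (norm x * ?z' + z (norm x))) * x $ a" for a
    using vf_apply_radial_tau[OF has_derivative_coord_radial[OF assms, of a], of h] assms(2)
    by (simp add: mult.commute power2_eq_square algebra_simps flip: power2_norm_eq_inner)
  have 2: "(\<Sum>j\<in>UNIV. pd a (\<lambda>y. radial_tau h y $ j) x *\<^sub>R (z (norm x) *\<^sub>R x) $ j) =
    (z (norm x) * norm x * ?k' + z (norm x) / h (norm x)) * x $ a" for a
    using sum_pd_radial_tau[OF assms(2), of a "z (norm x) *\<^sub>R x"] assms(2)
    by (simp add: power2_eq_square algebra_simps flip: power2_norm_eq_inner)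
  have "lie_form (radial_tau h) (\<lambda>y. z (norm y) *\<^sub>R y) x =
      (1 / h (norm x) * (norm x * ?z' + z (norm x)) + (z (norm x) * norm x * ?k' + z (norm x) / h (norm x))) *\<^sub>R x"
    unfolding lie_form_def vec_eq_iff vec_lambda_beta 1 2 by (simp add: algebra_simps)
  then show ?thesis ..
qed

lemma ip_radial_omega:
  fixes \<omega> :: "(real, 3) form"
  assumes "x \<noteq> 0" "\<omega> x = w *\<^sub>R x"
  shows "ip (spatial_metric h) \<omega> (omega i) x = 0"
  using assms h_nonzero by (simp add: ip_spatial_metric inner_omega_self)

lemma ip_omega_coord:
  assumes "x \<noteq> 0"
  shows "ip (spatial_metric h) (omega i) (dcl (\<lambda>y. y $ j)) x = proj_e i j x"
  using assms h_nonzero by (simp add: ip_spatial_metric inner_omega_self dcl_coord inner_axis omega_nth)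

lemma ip_norm_coord:
  assumes "x \<noteq> 0"
  shows "ip (spatial_metric h) (dcl norm) (dcl (\<lambda>y. y $ i)) x = 1 / (h (norm x))\<^sup>2 * (x $ i / norm x)"
  using assms h_nonzero[of "norm x"]
  by (simp add: ip_spatial_metric dcl_norm dcl_coord inner_axis flip: power2_norm_eq_inner)
      (simp add: power2_eq_square field_simps)

text \<open>
  The coefficient of \<open>u'(r)\<close> in the Laplacian of a radial function \<open>u(r)\<close>, when the vector field \<open>\<zeta>\<close> is dual
  to the 1-form \<open>z(r) x\<close>.  The case \<open>u(r) = r\<close> shows that it is the Laplacian
  of \<open>r\<close> itself.
\<close>

definition radial_drift :: "(real \<Rightarrow> real) \<Rightarrow> real \<Rightarrow> real" where
  "radial_drift z s = (s * vector_derivative (\<lambda>s. 1 / (s * h s)) (at s) + 3 / (s * h s)) / h s + z s * s / (h s)\<^sup>2"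

lemma smooth_inverse_sh: "smooth_on {0<..} (\<lambda>s. 1 / (s * h s))"
  by (intro smooth_on_divide smooth_on_mult smooth_on_const smooth_on_ident smooth_h) (auto simp: h_nonzero)

lemma smooth_radial_drift:
  "smooth_on {0<..} z \<Longrightarrow> smooth_on {0<..} (radial_drift z)"
  unfolding radial_drift_def[abs_def] power2_eq_square
  by (intro smooth_on_add smooth_on_divide smooth_on_mult smooth_on_vector_derivative smooth_inverse_sh
      smooth_on_const smooth_on_ident smooth_h) (auto simp: h_nonzero)

text \<open>
  The flux of \<open>u(r)\<close>, that is the gradient times the volume density, is \<open>U(r) x\<close> with
  \<open>U = \<sigma> u' / (r h)\<close>, and the Euclidean divergence of \<open>U(r) x\<close> is \<open>r U' + 3 U\<close>.
\<close>

lemma laplace_beltrami_radial: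
  fixes u :: "real \<Rightarrow> 'k::real_normed_field"
  assumes u: "smooth_on {0<..} u" and x: "x \<noteq> 0"
  shows "laplace_beltrami (spatial_metric h) (\<lambda>y. u (norm y)) x =
    radial_drift (\<lambda>_. 0) (norm x) *\<^sub>R vector_derivative u (at (norm x))
    + (1 / (h (norm x))\<^sup>2) *\<^sub>R vector_derivative (\<lambda>s. vector_derivative u (at s)) (at (norm x))"
proof -
  define r where "r = norm x"
  have r: "r > 0" and hr: "h r \<noteq> 0" using x h_nonzero by (auto simp: r_def)
  let ?w = "\<lambda>s. 1 / (s * h s)" and ?u' = "\<lambda>s. vector_derivative u (at s)"
  obtain \<sigma> where \<sigma>: "\<sigma> * \<sigma> = 1" "\<And>s. s > 0 \<Longrightarrow> \<bar>h s\<bar> = \<sigma> * h s" using abs_h by blast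
  define U where "U = (\<lambda>s. (\<sigma> * ?w s) *\<^sub>R ?u' s)"
  have su': "smooth_on {0<..} ?u'" by (rule smooth_on_vector_derivative[OF _ u]) simp
  have sU: "smooth_on {0<..} U"
    unfolding U_def scaleR_conv_of_real
    by (intro smooth_on_mult smooth_on_of_real smooth_inverse_sh smooth_on_const su') auto
  define U' where "U' = vector_derivative U (at r)"
  have "(U has_vector_derivative (\<sigma> * ?w r) *\<^sub>R vector_derivative ?u' (at r) + (\<sigma> * vector_derivative ?w (at r)) *\<^sub>R ?u' r) (at r)"
    unfolding U_def using r
    by (intro has_vector_derivative_scaleR DERIV_cmult smooth_on_has_real_derivative[OF smooth_inverse_sh]
        smooth_on_has_vector_derivative[OF su']) auto
  then have U': "U' = (\<sigma> * ?w r) *\<^sub>R vector_derivative ?u' (at r) + (\<sigma> * vector_derivative ?w (at r)) *\<^sub>R ?u' r"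
    unfolding U'_def by (rule vector_derivative_at)
  have flux: "vol (spatial_metric h) y *\<^sub>R (\<Sum>j\<in>UNIV. (matrix_inv (spatial_metric h y) $ i $ j) *\<^sub>R pd j (\<lambda>y. u (norm y)) y)
     = (y $ i) *\<^sub>R U (norm y)" if "y \<in> punctured_space" for y i
  proof -
    have y: "y \<noteq> 0" "norm y > 0" "h (norm y) \<noteq> 0" using that h_nonzero by (auto simp: punctured_space_def)
    have "(\<Sum>j\<in>UNIV. (matrix_inv (spatial_metric h y) $ i $ j) *\<^sub>R pd j (\<lambda>y. u (norm y)) y) =
      ((matrix_inv (spatial_metric h y) *v y) $ i / norm y) *\<^sub>R ?u' (norm y)"
      by (simp add: pd_radial[OF u y(1)] matrix_vector_mult_def sum_divide_distrib scaleR_sum_left)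
    also have "\<dots> = (y $ i / ((h (norm y))\<^sup>2 * norm y)) *\<^sub>R ?u' (norm y)"
      using y by (simp add: matrix_inv_spatial_metric radial_matrix_self)
    finally show ?thesis
      using y by (simp add: vol_spatial_metric \<sigma> U_def power2_eq_square mult.commute)
  qed
  have "pd i (\<lambda>y. vol (spatial_metric h) y *\<^sub>R (\<Sum>j\<in>UNIV. (matrix_inv (spatial_metric h y) $ i $ j) *\<^sub>R pd j (\<lambda>y. u (norm y)) y)) x
      = (x $ i * x $ i / r) *\<^sub>R U' + U r" for i
    using pd_cong[OF open_punctured _ flux] pd_coord_radial[OF sU x, of i i] x
    by (simp add: punctured_space_def U'_def r_def)
  then have "laplace_beltrami (spatial_metric h) (\<lambda>y. u (norm y)) x = (\<Sum>i\<in>UNIV. (x $ i * x $ i / r) *\<^sub>R U' + U r) /\<^sub>R (\<sigma> * h r)"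
    using x r by (simp add: laplace_beltrami_def vol_spatial_metric \<sigma> r_def)
  also have "(\<Sum>i\<in>UNIV. (x $ i * x $ i / r) *\<^sub>R U' + U r) = ((\<Sum>i\<in>UNIV. x $ i * x $ i) / r) *\<^sub>R U' + 3 *\<^sub>R U r"
    by (simp add: sum.distrib sum_divide_distrib scaleR_sum_left sum_constant_scaleR del: sum_constant)
  also have "(\<Sum>i\<in>UNIV. x $ i * x $ i) / r = r"
    using r by (simp add: sum_coord_sq r_def power2_eq_square)
  finally have "laplace_beltrami (spatial_metric h) (\<lambda>y. u (norm y)) x =
      ((r * (\<sigma> * vector_derivative ?w (at r)) + 3 * (\<sigma> * ?w r)) / (\<sigma> * h r)) *\<^sub>R ?u' r
      + (r * (\<sigma> * ?w r) / (\<sigma> * h r)) *\<^sub>R vector_derivative ?u' (at r)"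
    by (simp add: U' U_def scaleR_add_right divide_inverse mult_ac flip: scaleR_add_left)
      (simp add: algebra_simps)
  moreover have "\<sigma> \<noteq> 0"
    using \<sigma>(1) by auto
  moreover from this have "(r * (\<sigma> * vector_derivative ?w (at r)) + 3 * (\<sigma> * ?w r)) / (\<sigma> * h r) =
      radial_drift (\<lambda>_. 0) r"
    using mult_divide_mult_cancel_left[of \<sigma> "r * vector_derivative ?w (at r) + 3 * ?w r" "h r"]
    by (simp add: radial_drift_def algebra_simps)
  moreover from \<open>\<sigma> \<noteq> 0\<close> have "r * (\<sigma> * ?w r) / (\<sigma> * h r) = 1 / (h r)\<^sup>2"
    using r hr by (simp add: field_simps power2_eq_square)
  ultimately show ?thesis by (simp add: r_def)
qed

lemma Delta_radial:
  fixes u :: "real \<Rightarrow> 'k::real_normed_field"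
  assumes u: "smooth_on {0<..} u" and x: "x \<noteq> 0" and z: "zeta_form \<beta> x = z (norm x) *\<^sub>R x"
  shows "Delta (spatial_metric h) \<beta> (\<lambda>y. u (norm y)) x =
    radial_drift z (norm x) *\<^sub>R vector_derivative u (at (norm x))
    + (1 / (h (norm x))\<^sup>2) *\<^sub>R vector_derivative (\<lambda>s. vector_derivative u (at s)) (at (norm x))"
proof -
  have "sharp (spatial_metric h) (zeta_form \<beta>) x = (z (norm x) / (h (norm x))\<^sup>2) *\<^sub>R x"
    using x h_nonzero[of "norm x"]
    by (simp add: sharp_def z matrix_inv_spatial_metric matrix_vector_mult_scaleR radial_matrix_self)
  then have "vf_apply (sharp (spatial_metric h) (zeta_form \<beta>)) (\<lambda>y. u (norm y)) x =
     ((\<Sum>i\<in>UNIV. x $ i * x $ i) * (z (norm x) / (h (norm x))\<^sup>2 / norm x)) *\<^sub>R vector_derivative u (at (norm x))"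
    by (simp add: vf_apply_def pd_radial[OF u x] scaleR_sum_left sum_distrib_left mult_ac sum_divide_distrib)
  also have "(\<Sum>i\<in>UNIV. x $ i * x $ i) * (z (norm x) / (h (norm x))\<^sup>2 / norm x) = z (norm x) * norm x / (h (norm x))\<^sup>2"
    using x by (simp add: sum_coord_sq power2_eq_square)
  finally show ?thesis
    by (simp add: Delta_def laplace_beltrami_radial[OF u x] radial_drift_def scaleR_add_left)
qed

end

text \<open>
  Every \<open>\<beta>\<close> that depends on \<open>r\<close> alone has a radial \<open>\<zeta>\<^sup>*\<close>; its profile is recorded in the shape
  \<open>z(r) x\<close>.
\<close>

lemma zeta_form_radial:
  assumes "smooth_on {0<..} B" "x \<noteq> 0"
  shows "zeta_form (\<lambda>y. B (norm y)) x = (- (1/2) * (vector_derivative B (at (norm x)) / (norm x * B (norm x)))) *\<^sub>R x"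
  by (simp add: zeta_form_def dcl_def pd_radial[OF assms] vec_eq_iff inverse_eq_divide mult_ac)

section \<open>Smoothness of the coefficients\<close>

lemma CM_cong:
  "open M \<Longrightarrow> b \<in> CM M \<Longrightarrow> (\<And>x. x \<in> M \<Longrightarrow> a x = b x) \<Longrightarrow> a \<in> CM M"
  unfolding CM_def using smooth_on_cong by blast

lemma cfun_in_CM: "open M \<Longrightarrow> smooth_on M a \<Longrightarrow> cfun a \<in> CM M"
  by (simp add: CM_def cfun_def smooth_on_of_real)

lemma radial_in_CM: "smooth_on {0<..} u \<Longrightarrow> (\<lambda>x. u (norm x)) \<in> CM punctured_space"
  by (simp add: CM_def punctured_space_def smooth_on_radial)

lemma cfun_radial_in_CM: "smooth_on {0<..} u \<Longrightarrow> cfun (\<lambda>x. u (norm x)) \<in> CM punctured_space"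
  by (intro cfun_in_CM open_punctured) (simp add: punctured_space_def smooth_on_radial)

lemma smooth_on_coord: "open S \<Longrightarrow> smooth_on S (\<lambda>x::real^'n. x $ i)"
  by (rule smooth_on_bounded_linear[OF _ bounded_linear_vec_nth smooth_on_id])

lemma smooth_on_norm: "smooth_on punctured_space norm"
  using smooth_on_radial[OF smooth_on_ident] by (simp add: punctured_space_def)

lemma smooth_on_proj_e: "smooth_on punctured_space (proj_e i j)"
  unfolding proj_e_def[abs_def] power2_eq_square using open_punctured
  by (intro smooth_on_diff smooth_on_divide smooth_on_mult smooth_on_const smooth_on_coord smooth_on_norm)
    (auto simp: punctured_space_def)

lemma cform_omega_in_forms: "cform (omega i) \<in> forms punctured_space"
  by (simp add: forms_def cform_def omega_nth smooth_on_of_real smooth_on_proj_e open_punctured)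

lemma dcl_radial_in_forms:
  fixes u :: "real \<Rightarrow> 'k::real_normed_field"
  assumes "smooth_on {0<..} u"
  shows "dcl (\<lambda>x. u (norm x)) \<in> forms punctured_space"
proof -
  have "smooth_on punctured_space (\<lambda>x::real^3. x $ i / norm x)" for i
    using open_punctured
    by (intro smooth_on_divide smooth_on_coord smooth_on_norm) (auto simp: punctured_space_def)
  moreover have "smooth_on punctured_space (\<lambda>x. vector_derivative u (at (norm x)))"
    using smooth_on_radial[OF smooth_on_vector_derivative[OF _ assms]] by (simp add: punctured_space_def)
  ultimately have s: "smooth_on punctured_space (\<lambda>x. of_real (x $ i / norm x) * vector_derivative u (at (norm x)))" for i
    using open_punctured by (intro smooth_on_mult smooth_on_of_real)
  have "smooth_on punctured_space (\<lambda>x. pd i (\<lambda>y. u (norm y)) x)" for i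
    by (rule smooth_on_cong[OF open_punctured s[of i]])
      (simp add: pd_radial[OF assms] punctured_space_def scaleR_conv_of_real)
  then show ?thesis by (simp add: forms_def dcl_def)
qed

section \<open>Commutators in a quantum calculus\<close>

lemma (in bimodule) lact_zero_left [simp]: "0 \<triangleright> w = 0"
  using lact_add_left[of 0 0 w] by simp

context quantum_calculus
begin

lemma fn_eq_on:
  assumes "open M" "b \<in> CM M" "\<And>x. x \<in> M \<Longrightarrow> a x = b x"
  shows "fn a = fn b"
  using assms CM_cong[OF assms(1,2)] by (intro fn_cong) auto

lemma fn_eq_zero:
  assumes "open M" "\<And>x. x \<in> M \<Longrightarrow> a x = 0"
  shows "fn a = 0"
  using fn_eq_on[OF assms(1), of "\<lambda>_. 0" a] assms fn_const[of 0] by (simp add: CM_def)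

lemma fn_commute: "a \<in> CM M \<Longrightarrow> b \<in> CM M \<Longrightarrow> fn a * fn b = fn b * fn a"
  using fn_mult[of a b] fn_mult[of b a] by (simp add: mult.commute)

text \<open>
  Applying the derivation \<open>d\<close> to \<open>[a, t] = \<lambda> \<tau>(a)\<close> yields \<open>[da, t] + [a, dt]\<close>, and the second commutator is
  \<open>\<lambda> da\<close>.  So the commutator of \<open>da\<close> with \<open>t\<close> is known without evaluating the second-order terms of
  \<open>[\<omega>, t]\<close>.
\<close>

lemma d_fn_t_commutator:
  assumes "a \<in> CM M"
  shows "d (fn a) \<triangleleft> t - t \<triangleright> d (fn a) = scaleW lam (d (fn (vf_apply \<tau> a)) - d (fn a))"
proof -
  have "d (fn a * t) = d (fn a * t - t * fn a) + d (t * fn a)"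
    by (simp flip: d_add)
  then have "d (fn a) \<triangleleft> t + fn a \<triangleright> d t - (d t \<triangleleft> fn a + t \<triangleright> d (fn a)) = scaleW lam (d (fn (vf_apply \<tau> a)))"
    by (simp add: fn_t[OF assms] d_scale d_mult)
  then show ?thesis
    using fn_dt[OF assms] by (simp add: W.scale_right_diff_distrib algebra_simps)
qed

text \<open>
  The quantum correction of \<open>da\<close> is a multiple of \<open>\<theta>'\<close>, which commutes with functions, so that only
  the classical part contributes.
\<close>

lemma d_fn_fn_commutator:
  assumes a: "a \<in> CM M" "dcl a \<in> forms M" "Delta g \<beta> a \<in> CM M" and b: "b \<in> CM M"
  shows "d (fn a) \<triangleleft> fn b - fn b \<triangleright> d (fn a) = scaleW lam (fn (ip g (dcl a) (dcl b)) \<triangleright> \<theta>)"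
proof -
  have "(fn (Delta g \<beta> a) \<triangleright> \<theta>) \<triangleleft> fn b = fn b \<triangleright> fn (Delta g \<beta> a) \<triangleright> \<theta>"
    using theta_fn[OF b] by (simp add: assoc fn_commute[OF b a(3)] flip: lact_mult)
  then show ?thesis
    using form_fn[OF a(2) b]
    by (simp add: d_fn[OF a(1)] ract_add_left lact_add_right ract_scale_left lact_scale_right)
qed

end

section \<open>The static, spherically symmetric calculus\<close>

locale static_calculus =
  radial_lapse h +
  quantum_calculus punctured_space "spatial_metric h" "radial_tau h" "static_beta c f"
    lam scaleA scaleW lact ract fn form t \<theta> d
  for h f :: "real \<Rightarrow> real"
    and c :: real
    and lam :: "'k::real_normed_field"
    and scaleA :: "'k \<Rightarrow> 'a::ring_1 \<Rightarrow> 'a"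
    and scaleW :: "'k \<Rightarrow> 'w::ab_group_add \<Rightarrow> 'w"
    and lact :: "'a \<Rightarrow> 'w \<Rightarrow> 'w" (infixr "\<triangleright>" 75)
    and ract :: "'w \<Rightarrow> 'a \<Rightarrow> 'w" (infixl "\<triangleleft>" 75)
    and fn :: "(real^3 \<Rightarrow> 'k) \<Rightarrow> 'a"
    and form :: "('k, 3) form \<Rightarrow> 'w"
    and t :: 'a
    and \<theta> :: 'w
    and d :: "'a \<Rightarrow> 'w" +
  assumes smooth_f: "smooth_on {0<..} f"
    and f_nonzero: "s > 0 \<Longrightarrow> f s \<noteq> 0"
    and c_nonzero: "c \<noteq> 0"
begin

abbreviation "\<beta> \<equiv> static_beta c f"
abbreviation "beta_profile \<equiv> \<lambda>s. - (1 / (c\<^sup>2 * (f s)\<^sup>2))"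
abbreviation "zeta_profile \<equiv> \<lambda>s. - (1/2) * (vector_derivative beta_profile (at s) / (s * beta_profile s))"

lemma smooth_beta_profile: "smooth_on {0<..} beta_profile"
proof -
  have "smooth_on {0<..} (\<lambda>s. - 1 / (c * c * (f s * f s)))"
    using c_nonzero f_nonzero
    by (intro smooth_on_divide smooth_on_mult smooth_on_const smooth_f) auto
  then show ?thesis by (simp add: power2_eq_square)
qed

lemma smooth_zeta_profile: "smooth_on {0<..} zeta_profile"
  using c_nonzero f_nonzero
  by (intro smooth_on_divide smooth_on_mult smooth_on_const smooth_on_ident
      smooth_on_vector_derivative smooth_beta_profile) auto

lemma zeta_static: "x \<noteq> 0 \<Longrightarrow> zeta_form \<beta> x = zeta_profile (norm x) *\<^sub>R x"
  unfolding static_beta_def by (rule zeta_form_radial[OF smooth_beta_profile])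

abbreviation "radial_deriv u \<equiv> (\<lambda>x::real^3. vector_derivative u (at (norm x)))"
abbreviation "radial_deriv2 u \<equiv> (\<lambda>x::real^3. vector_derivative (\<lambda>s. vector_derivative u (at s)) (at (norm x)))"

lemma radial_deriv_in_CM: "smooth_on {0<..} u \<Longrightarrow> radial_deriv u \<in> CM punctured_space"
  by (rule radial_in_CM, rule smooth_on_vector_derivative) auto

lemma radial_deriv2_in_CM: "smooth_on {0<..} u \<Longrightarrow> radial_deriv2 u \<in> CM punctured_space"
  by (rule radial_in_CM, rule smooth_on_vector_derivative, simp, rule smooth_on_vector_derivative) auto

lemma CM_mult: "a \<in> CM punctured_space \<Longrightarrow> b \<in> CM punctured_space \<Longrightarrow> (\<lambda>x::real^3. a x * b x :: 'k) \<in> CM punctured_space"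
  by (simp add: CM_def smooth_on_mult open_punctured)

lemma CM_add: "a \<in> CM punctured_space \<Longrightarrow> b \<in> CM punctured_space \<Longrightarrow> (\<lambda>x::real^3. a x + b x :: 'k) \<in> CM punctured_space"
  by (simp add: CM_def smooth_on_add open_punctured)

abbreviation drift :: "real^3 \<Rightarrow> 'k" where "drift \<equiv> cfun (\<lambda>x. radial_drift zeta_profile (norm x))"
abbreviation inverse_grr :: "real^3 \<Rightarrow> 'k" where "inverse_grr \<equiv> \<lambda>x. of_real (1 / (h (norm x))\<^sup>2)"

lemma drift_in_CM: "drift \<in> CM punctured_space"
  by (rule cfun_radial_in_CM[OF smooth_radial_drift[OF smooth_zeta_profile]])

lemma inverse_grr_in_CM: "inverse_grr \<in> CM punctured_space"
proof -
  have "smooth_on {0<..} (\<lambda>s. 1 / (h s * h s))"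
    by (intro smooth_on_divide smooth_on_mult smooth_on_const smooth_h) (auto simp: h_nonzero)
  from cfun_radial_in_CM[OF this] show ?thesis by (simp add: cfun_def power2_eq_square)
qed

lemma Delta_static:
  fixes u :: "real \<Rightarrow> 'k"
  assumes "smooth_on {0<..} u" "x \<noteq> 0"
  shows "Delta (spatial_metric h) \<beta> (\<lambda>y. u (norm y)) x = radial_deriv u x * drift x + inverse_grr x * radial_deriv2 u x"
  using Delta_radial[where z = zeta_profile, OF assms zeta_static[OF assms(2)]]
  by (simp add: scaleR_conv_of_real cfun_def mult.commute)

lemma Delta_static_in_CM:
  fixes u :: "real \<Rightarrow> 'k"
  assumes "smooth_on {0<..} u"
  shows "Delta (spatial_metric h) \<beta> (\<lambda>y. u (norm y)) \<in> CM punctured_space"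
  by (rule CM_cong[OF open_punctured CM_add[OF CM_mult[OF radial_deriv_in_CM[OF assms] drift_in_CM] 
        CM_mult[OF inverse_grr_in_CM radial_deriv2_in_CM[OF assms]]]])
    (simp add: Delta_static[OF assms] punctured_space_def)

lemma smooth_of_real: "smooth_on {0<..} (of_real :: real \<Rightarrow> 'k)"
  by (rule smooth_on_of_real[OF _ smooth_on_ident]) simp

lemma cfun_norm: "cfun norm = (\<lambda>x::real^3. of_real (norm x) :: 'k)"
  by (simp add: cfun_def)

lemma cfun_norm_in_CM: "(cfun norm :: _ \<Rightarrow> 'k) \<in> CM punctured_space"
  unfolding cfun_norm by (rule radial_in_CM[OF smooth_of_real])

lemma dcl_cfun_norm_in_forms: "(dcl (cfun norm) :: ('k, 3) form) \<in> forms punctured_space"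
  unfolding cfun_norm by (rule dcl_radial_in_forms[OF smooth_of_real])

lemma vector_derivative_of_real: "vector_derivative (of_real :: real \<Rightarrow> 'k) (at s) = 1"
  using bounded_linear.has_vector_derivative[OF bounded_linear_of_real has_vector_derivative_id[of "at s"]]
  by (simp add: vector_derivative_at)

lemma Delta_cfun_norm:
  "x \<noteq> 0 \<Longrightarrow> (Delta (spatial_metric h) \<beta> (cfun norm) x :: 'k) = drift x"
  unfolding cfun_norm by (subst Delta_static[OF smooth_of_real]) (simp_all add: vector_derivative_of_real)

lemma d_cfun_norm: "d (fn (cfun norm)) = form (dcl (cfun norm)) + scaleW (lam / 2) (fn drift \<triangleright> \<theta>)"
  using fn_eq_on[OF open_punctured drift_in_CM, of "Delta (spatial_metric h) \<beta> (cfun norm)"]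
  by (simp add: d_fn[OF cfun_norm_in_CM] Delta_cfun_norm punctured_space_def)

text \<open>
  On radial functions \<open>\<Delta> u = u' \<Delta> r + u'' / h\<^sup>2\<close>, while classically \<open>du = u' dr\<close>.  Hence the terms with
  \<open>\<Delta> r\<close> are exactly those that turn the classical \<open>dr\<close> into the quantum one, and only the second
  derivative remains.
\<close>

lemma d_radial:
  fixes u :: "real \<Rightarrow> 'k"
  assumes u: "smooth_on {0<..} u"
  shows "d (fn (\<lambda>x. u (norm x))) = fn (radial_deriv u) \<triangleright> d (fn (cfun norm))
    + scaleW (lam / 2) (fn (\<lambda>x. inverse_grr x * radial_deriv2 u x) \<triangleright> \<theta>)"
proof -
  note in_CM = radial_deriv_in_CM[OF u] drift_in_CM CM_mult[OF radial_deriv_in_CM[OF u] drift_in_CM]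
    CM_mult[OF inverse_grr_in_CM radial_deriv2_in_CM[OF u]]
  have "form (dcl (\<lambda>x. u (norm x))) = form (\<lambda>x. radial_deriv u x *s dcl (cfun norm) x)"
  proof (rule form_cong)
    show "dcl (\<lambda>x. u (norm x)) x = radial_deriv u x *s dcl (cfun norm) x" if "x \<in> punctured_space" for x
      using that unfolding cfun_norm
      by (simp add: dcl_def vec_eq_iff punctured_space_def pd_radial[OF u] pd_radial[OF smooth_of_real]
          vector_derivative_of_real scaleR_conv_of_real)
    show "(\<lambda>x. radial_deriv u x *s dcl (cfun norm) x) \<in> forms punctured_space"
      using dcl_cfun_norm_in_forms in_CM(1)
      by (simp add: forms_def CM_def smooth_on_mult open_punctured)
  qed (rule dcl_radial_in_forms[OF u])
  also have "\<dots> = fn (radial_deriv u) \<triangleright> form (dcl (cfun norm))"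
    by (rule form_mult[OF in_CM(1) dcl_cfun_norm_in_forms])
  finally have 1: "form (dcl (\<lambda>x. u (norm x))) = \<dots>" .
  have "fn (Delta (spatial_metric h) \<beta> (\<lambda>x. u (norm x))) = fn (\<lambda>x. radial_deriv u x * drift x + inverse_grr x * radial_deriv2 u x)"
    by (rule fn_eq_on[OF open_punctured CM_add[OF in_CM(3,4)]])
      (simp add: Delta_static[OF u] punctured_space_def)
  also have "\<dots> = fn (radial_deriv u) * fn drift + fn (\<lambda>x. inverse_grr x * radial_deriv2 u x)"
    by (simp only: fn_add[OF in_CM(3,4)] fn_mult[OF in_CM(1,2)])
  finally have 2: "fn (Delta (spatial_metric h) \<beta> (\<lambda>x. u (norm x))) = \<dots>" .
  show ?thesis
    by (simp only: d_fn[OF radial_in_CM[OF u]] 1 2 d_cfun_norm lact_add_left lact_add_right lact_mult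
        lact_scale_right W.scale_right_distrib add.assoc)
qed

lemma coord_in_CM: "cfun (\<lambda>x::real^3. x $ i) \<in> CM punctured_space"
  by (rule cfun_in_CM[OF open_punctured smooth_on_coord[OF open_punctured]])

lemma differentiable_coord: "(\<lambda>x::real^3. x $ i) differentiable at x"
  unfolding differentiable_def
  using bounded_linear_imp_has_derivative[OF bounded_linear_vec_nth] by blast

lemma differentiable_norm: "x \<noteq> 0 \<Longrightarrow> norm differentiable at (x :: real^3)"
  unfolding differentiable_def using has_derivative_norm_at by blast

lemma coord_t: "fn (cfun (\<lambda>x. x $ i)) * t - t * fn (cfun (\<lambda>x. x $ i)) =
    scaleA lam (fn (cfun (\<lambda>x. 1 / h (norm x))) * fn (cfun (\<lambda>x. x $ i)))"
proof -
  have "vf_apply (radial_tau h) (cfun (\<lambda>x. x $ i)) x = (cfun (\<lambda>x. 1 / h (norm x)) x * cfun (\<lambda>x. x $ i) x :: 'k)" for x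
    using vf_apply_radial_tau[OF bounded_linear_imp_has_derivative[OF bounded_linear_vec_nth[of i]], of h x]
    by (simp add: vf_apply_cfun[OF differentiable_coord]) (simp add: cfun_def)
  then have "vf_apply (radial_tau h) (cfun (\<lambda>x. x $ i)) = (\<lambda>x. cfun (\<lambda>x. 1 / h (norm x)) x * cfun (\<lambda>x. x $ i) x :: 'k)" ..
  then show ?thesis
    by (simp add: fn_t[OF coord_in_CM] fn_mult[OF cfun_radial_in_CM[OF smooth_inverse_h] coord_in_CM])
qed

lemma omega_coord: 
  "form (cform (omega i)) \<triangleleft> fn (cfun (\<lambda>x. x $ j)) - fn (cfun (\<lambda>x. x $ j)) \<triangleright> form (cform (omega i))
    = scaleW lam (fn (cfun (proj_e i j)) \<triangleright> \<theta>)"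
proof -
  have "ip (spatial_metric h) (cform (omega i)) (dcl (cfun (\<lambda>x. x $ j))) x = (cfun (proj_e i j) x :: 'k)"
    if "x \<in> punctured_space" for x
  proof -
    have "ip (spatial_metric h) (cform (omega i)) (dcl (cfun (\<lambda>x. x $ j))) x =
        (of_real (ip (spatial_metric h) (omega i) (dcl (\<lambda>x. x $ j)) x) :: 'k)"
      by (rule ip_of_real[OF refl dcl_cfun[OF differentiable_coord]])
    then show ?thesis
      using that by (simp add: punctured_space_def cfun_def ip_omega_coord)
  qed
  from fn_eq_on[OF open_punctured cfun_in_CM[OF open_punctured smooth_on_proj_e] this] show ?thesis
    by (simp add: form_fn[OF cform_omega_in_forms coord_in_CM])
qed

lemma dr_coord:
  "d (fn (cfun norm)) \<triangleleft> fn (cfun (\<lambda>x. x $ i)) - fn (cfun (\<lambda>x. x $ i)) \<triangleright> d (fn (cfun norm)) =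
    scaleW lam (fn (cfun (\<lambda>x. 1 / (h (norm x))\<^sup>2 * (x $ i / norm x))) \<triangleright> \<theta>)"
proof -
  have eq: "ip (spatial_metric h) (dcl (cfun norm)) (dcl (cfun (\<lambda>x. x $ i))) x =
      (cfun (\<lambda>x. 1 / (h (norm x))\<^sup>2 * (x $ i / norm x)) x :: 'k)" if "x \<in> punctured_space" for x
    using that ip_norm_coord[of x i]
    by (simp add: punctured_space_def cfun_def
        ip_of_real[OF dcl_cfun[OF differentiable_norm] dcl_cfun[OF differentiable_coord], unfolded cfun_def])
  have sm: "smooth_on punctured_space (\<lambda>x::real^3. 1 / (h (norm x))\<^sup>2 * (x $ i / norm x))"
    using open_punctured smooth_on_radial[OF smooth_h] h_nonzero unfolding power2_eq_square
    by (intro smooth_on_mult smooth_on_divide smooth_on_const smooth_on_coord smooth_on_norm)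
      (auto simp: punctured_space_def)
  have "d (fn (cfun norm)) \<triangleleft> fn (cfun (\<lambda>x. x $ i)) - fn (cfun (\<lambda>x. x $ i)) \<triangleright> d (fn (cfun norm)) =
    scaleW lam (fn (ip (spatial_metric h) (dcl (cfun norm)) (dcl (cfun (\<lambda>x. x $ i)))) \<triangleright> \<theta>)"
    using Delta_static_in_CM[OF smooth_of_real]
    by (intro d_fn_fn_commutator cfun_norm_in_CM dcl_cfun_norm_in_forms coord_in_CM) (simp add: cfun_norm)
  then show ?thesis
    using fn_eq_on[OF open_punctured cfun_in_CM[OF open_punctured sm] eq] by simp
qed

lemma fn_radial_minus_one:
  fixes u :: "real \<Rightarrow> real"
  assumes "smooth_on {0<..} u"
  shows "fn (cfun (\<lambda>x. u (norm x) - 1)) = fn (cfun (\<lambda>x. u (norm x))) - 1"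
  using fn_add[OF cfun_radial_in_CM[OF assms], of "\<lambda>_. - 1"] fn_const[of "-1"]
  by (simp add: cfun_def CM_def open_punctured)

text \<open>
  Both terms of order \<open>\<lambda>\<^sup>2\<close> pair \<open>\<omega>\<^sub>i\<close> with a radial 1-form: \<open>d\<alpha>\<close>, because \<open>\<alpha>\<close> is a function of \<open>r\<close>, and
  \<open>L\<^sub>\<tau> \<zeta>\<^sup>*\<close>, because \<open>\<tau>\<close> and \<open>\<zeta>\<^sup>*\<close> are radial.  As \<open>\<omega>\<^sub>i\<close> is tangential they vanish, and what remains is the
  classical Lie derivative \<open>L\<^sub>\<tau> \<omega>\<^sub>i = \<omega>\<^sub>i / h\<close>.
\<close>

lemma omega_t: 
  "form (cform (omega i)) \<triangleleft> t - t \<triangleright> form (cform (omega i))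
    = scaleW lam (fn (cfun (\<lambda>x. 1 / h (norm x) - 1)) \<triangleright> form (cform (omega i)))"
proof -
  have radial_zero: "fn (ip (spatial_metric h) \<omega> (cform (omega i))) = 0"
    if radial: "\<And>x. x \<noteq> 0 \<Longrightarrow> \<exists>\<omega>' w. \<omega> x = cform \<omega>' x \<and> \<omega>' x = w *\<^sub>R x" for \<omega>
  proof (rule fn_eq_zero[OF open_punctured])
    fix x :: "real^3" assume x: "x \<in> punctured_space"
    then obtain \<omega>' w where "\<omega> x = cform \<omega>' x" "\<omega>' x = w *\<^sub>R x"
      using x radial[of x] unfolding punctured_space_def by blast
    then show "ip (spatial_metric h) \<omega> (cform (omega i)) x = 0"
      using x ip_radial_omega[of x \<omega>' w i] ip_of_real[of \<omega> x \<omega>' "cform (omega i)" "omega i"]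
      by (simp add: punctured_space_def)
  qed
  have "fn (ip (spatial_metric h) (dcl (cfun (alpha (spatial_metric h) (radial_tau h)))) (cform (omega i))) = 0"
  proof (rule radial_zero)
    fix x :: "real^3" assume x: "x \<noteq> 0"
    have s: "smooth_on {0<..} (\<lambda>s. 2 / h s - 1)"
      by (intro smooth_on_diff smooth_on_divide smooth_on_const smooth_h) (auto simp: h_nonzero)
    have "pd j (cfun (alpha (spatial_metric h) (radial_tau h))) x = (pd j (cfun (\<lambda>x. 2 / h (norm x) - 1)) x :: 'k)" for j
      using x by (intro pd_cong[OF open_punctured]) (auto simp: punctured_space_def cfun_def alpha_radial)
    then have "dcl (cfun (alpha (spatial_metric h) (radial_tau h))) x = (dcl (cfun (\<lambda>x. 2 / h (norm x) - 1)) x :: 'k^3)"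
      by (simp add: dcl_def)
    also have "\<dots> = cform (dcl (\<lambda>x. 2 / h (norm x) - 1)) x"
      using has_derivative_radial[OF s x] by (intro dcl_cfun) (auto simp: differentiable_def)
    finally have "dcl (cfun (alpha (spatial_metric h) (radial_tau h))) x = (\<dots> :: 'k^3)" .
    moreover have "dcl (\<lambda>x. 2 / h (norm x) - 1) x = (vector_derivative (\<lambda>s. 2 / h s - 1) (at (norm x)) / norm x) *\<^sub>R x"
      by (simp add: dcl_def vec_eq_iff pd_radial[OF s x])
    ultimately show "\<exists>\<omega>' w. dcl (cfun (alpha (spatial_metric h) (radial_tau h))) x = (cform \<omega>' x :: 'k^3) \<and> \<omega>' x = w *\<^sub>R x"
      by blast
  qed
  moreover have "fn (ip (spatial_metric h) (cform (lie_form (radial_tau h) (zeta_form \<beta>))) (cform (omega i))) = 0"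
  proof (rule radial_zero)
    fix x :: "real^3" assume x: "x \<noteq> 0"
    have "lie_form (radial_tau h) (zeta_form \<beta>) x = lie_form (radial_tau h) (\<lambda>y. zeta_profile (norm y) *\<^sub>R y) x"
      using x by (intro lie_form_cong[OF open_punctured]) (auto simp: punctured_space_def zeta_static)
    then show "\<exists>\<omega>' w. cform (lie_form (radial_tau h) (zeta_form \<beta>)) x = (cform \<omega>' x :: 'k^3) \<and> \<omega>' x = w *\<^sub>R x"
      using lie_form_radial_tau_radial[OF smooth_zeta_profile x] by metis
  qed
  moreover have "form (lie_form (radial_tau h) (cform (omega i))) = fn (cfun (\<lambda>x. 1 / h (norm x))) \<triangleright> form (cform (omega i))"
  proof -
    have k: "(cfun (\<lambda>x. 1 / h (norm x)) :: _ \<Rightarrow> 'k) \<in> CM punctured_space"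
      by (rule cfun_radial_in_CM[OF smooth_inverse_h])
    have s: "smooth_on punctured_space (\<lambda>x. (cfun (\<lambda>x. 1 / h (norm x)) x *s cform (omega i) x :: 'k^3) $ j)" for j
    proof -
      have "(cform (omega i) :: ('k, 3) form) \<in> forms punctured_space"
        by (rule cform_omega_in_forms)
      then show ?thesis
        using k by (simp add: forms_def CM_def smooth_on_mult open_punctured)
    qed
    have eq: "lie_form (radial_tau h) (cform (omega i)) x = (cfun (\<lambda>x. 1 / h (norm x)) x *s cform (omega i) x :: 'k^3)"
      if "x \<in> punctured_space" for x
      using that by (simp add: lie_form_radial_tau_omega punctured_space_def)
    have "smooth_on punctured_space (\<lambda>x. lie_form (radial_tau h) (cform (omega i) :: ('k, 3) form) x $ j)" for j
      by (rule smooth_on_cong[OF open_punctured s[of j]]) (simp only: eq)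
    then have "lie_form (radial_tau h) (cform (omega i) :: ('k, 3) form) \<in> forms punctured_space"
      by (simp add: forms_def)
    then have "form (lie_form (radial_tau h) (cform (omega i))) =
        form (\<lambda>x. cfun (\<lambda>x. 1 / h (norm x)) x *s cform (omega i) x)"
      using s eq by (intro form_cong) (auto simp: forms_def)
    then show ?thesis by (simp add: form_mult[OF k cform_omega_in_forms])
  qed
  moreover have "(fn (cfun (\<lambda>x. 1 / h (norm x))) - 1) \<triangleright> w = fn (cfun (\<lambda>x. 1 / h (norm x))) \<triangleright> w - w" for w
    using lact_add_left[of "fn (cfun (\<lambda>x. 1 / h (norm x))) - 1" 1 w] by (simp add: lact_one)
  ultimately show ?thesis
    by (simp add: form_t[OF cform_omega_in_forms] fn_radial_minus_one[OF smooth_inverse_h])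
qed

lemma theta_t_static: "\<theta> \<triangleleft> t - t \<triangleright> \<theta> = scaleW lam (fn (cfun (\<lambda>x. 2 / h (norm x) - 1)) \<triangleright> \<theta>)"
proof -
  have "smooth_on {0<..} (\<lambda>s. 2 / h s - 1)"
    by (intro smooth_on_diff smooth_on_divide smooth_on_const smooth_h) (auto simp: h_nonzero)
  then have "fn (cfun (alpha (spatial_metric h) (radial_tau h))) = fn (cfun (\<lambda>x. 2 / h (norm x) - 1))"
    by (intro fn_eq_on[OF open_punctured] cfun_radial_in_CM) (auto simp: cfun_def alpha_radial punctured_space_def)
  then show ?thesis by (simp add: theta_t)
qed

text \<open>
  This is the commutator of \<open>da\<close> with \<open>t\<close> for \<open>a = r\<close>, as \<open>\<tau>(r) = r / h\<close>.
\<close>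

lemma dr_t: "d (fn (cfun norm)) \<triangleleft> t - t \<triangleright> d (fn (cfun norm)) =
    scaleW lam (d (fn (cfun (\<lambda>x. norm x / h (norm x)))) - d (fn (cfun norm)))"
proof -
  have "smooth_on {0<..} (\<lambda>s. s / h s)"
    by (intro smooth_on_divide smooth_on_ident smooth_h) (auto simp: h_nonzero)
  then have "fn (vf_apply (radial_tau h) (cfun norm)) = fn (cfun (\<lambda>x. norm x / h (norm x)))"
    using vf_apply_radial_tau_radial[OF smooth_of_real, of _ h]
    by (intro fn_eq_on[OF open_punctured] cfun_radial_in_CM)
      (auto simp: cfun_def punctured_space_def vector_derivative_of_real scaleR_conv_of_real)
  then show ?thesis by (simp add: d_fn_t_commutator[OF cfun_norm_in_CM])
qed

end

theorem proposition4p9: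
  fixes h f :: "real \<Rightarrow> real"
    and c :: real
    and lam :: "'k::real_normed_field"
    and scaleA :: "'k \<Rightarrow> 'a::ring_1 \<Rightarrow> 'a"
    and scaleW :: "'k \<Rightarrow> 'w::ab_group_add \<Rightarrow> 'w"
    and lact :: "'a \<Rightarrow> 'w \<Rightarrow> 'w" (infixr "\<triangleright>" 75)
    and ract :: "'w \<Rightarrow> 'a \<Rightarrow> 'w" (infixl "\<triangleleft>" 75)
    and fn :: "(real^3 \<Rightarrow> 'k) \<Rightarrow> 'a"
    and form :: "('k, 3) form \<Rightarrow> 'w"
    and t r :: 'a
    and \<theta> :: 'w
    and d :: "'a \<Rightarrow> 'w"
    and X :: "3 \<Rightarrow> 'a"
    and W :: "3 \<Rightarrow> 'w"
  assumes h: "smooth_on {0<..} h" "\<And>s. s > 0 \<Longrightarrow> h s \<noteq> 0"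
    and f: "smooth_on {0<..} f" "\<And>s. s > 0 \<Longrightarrow> f s \<noteq> 0"
    and c: "c \<noteq> 0"
    and calculus: "quantum_calculus punctured_space (spatial_metric h) (radial_tau h)
      (static_beta c f) lam scaleA scaleW lact ract fn form t \<theta> d"
    and X: "\<And>i. X i = fn (cfun (\<lambda>x. x $ i))"
    and r: "r = fn (cfun norm)"
    and W: "\<And>i. W i = form (cform (omega i))"
  shows "conformal_killing punctured_space (spatial_metric h) (radial_tau h)
    \<and> (\<forall>i j. X i * X j - X j * X i = 0)
    \<and> (\<forall>i. X i * t - t * X i = scaleA lam (fn (cfun (\<lambda>x. 1 / h (norm x))) * X i))
    \<and> (\<forall>i j. W i \<triangleleft> X j - X j \<triangleright> W i = scaleW lam (fn (cfun (proj_e i j)) \<triangleright> \<theta>))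
    \<and> (\<forall>i. d r \<triangleleft> X i - X i \<triangleright> d r =
          scaleW lam (fn (cfun (\<lambda>x. 1 / (h (norm x))\<^sup>2 * (x $ i / norm x))) \<triangleright> \<theta>))
    \<and> (\<forall>i. \<theta> \<triangleleft> X i - X i \<triangleright> \<theta> = 0)
    \<and> (\<forall>i. W i \<triangleleft> t - t \<triangleright> W i = scaleW lam (fn (cfun (\<lambda>x. 1 / h (norm x) - 1)) \<triangleright> W i))
    \<and> \<theta> \<triangleleft> t - t \<triangleright> \<theta> = scaleW lam (fn (cfun (\<lambda>x. 2 / h (norm x) - 1)) \<triangleright> \<theta>)
    \<and> (\<forall>i. X i \<triangleright> d t - d t \<triangleleft> X i = scaleW lam (d (X i)))
    \<and> d t \<triangleleft> t - t \<triangleright> d t =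
        scaleW lam (fn (cfun (\<lambda>x. - 1 / (c\<^sup>2 * (f (norm x))\<^sup>2))) \<triangleright> \<theta>) - scaleW lam (d t)
    \<and> d r \<triangleleft> t - t \<triangleright> d r = scaleW lam (d (fn (cfun (\<lambda>x. norm x / h (norm x)))) - d r)
    \<and> (\<forall>g. smooth_on {0<..} g \<longrightarrow>
        d (fn (\<lambda>x. g (norm x))) =
          fn (\<lambda>x. vector_derivative g (at (norm x))) \<triangleright> d r
          + scaleW (lam / 2) (fn (\<lambda>x. of_real (1 / (h (norm x))\<^sup>2)
              * vector_derivative (\<lambda>s. vector_derivative g (at s)) (at (norm x))) \<triangleright> \<theta>))"
proof -
  interpret static_calculus h f c lam scaleA scaleW lact ract fn form t \<theta> d
    using calculus h f c
    by (intro static_calculus.intro radial_lapse.intro static_calculus_axioms.intro) auto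
  have beta: "cfun \<beta> = (cfun (\<lambda>x. - 1 / (c\<^sup>2 * (f (norm x))\<^sup>2)) :: _ \<Rightarrow> 'k)"
    by (simp add: static_beta_def)
  show ?thesis
    unfolding X r W
    by (intro conjI allI impI conformal_killing_radial_tau coord_t omega_coord dr_coord omega_t
        theta_t_static dr_t d_radial theta_fn[OF coord_in_CM] fn_dt[OF coord_in_CM] dt_t[unfolded beta])
      (simp add: fn_commute coord_in_CM)
qed

end
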